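(* Assume that $F=\frac1n\sum_{i=1}^nf_i$ is quadratic and $\mu$-strongly convex, and that each $f_i$ is convex with $f_i\in C_L^1(\mathbb R^d)$ (the $f_i$ need not be quadratic). Let $\alpha>4$ be any constant, let $k_0:=\alpha\cdot\kappa$, and consider the step sizes $\eta_i^1=\frac{2\alpha/\mu}{k_0+i}$ for $i\in[n]$, and $\eta_i^k=\frac{2\alpha/\mu}{k_0+nk}$ for $k\in\{2,\dots,K\}$ and $i\in[n]$. Assume that the bounded iterates assumption holds. Then, for any $K\ge1$, RandomShuffle with step sizes $\eta_i^k$ and initialization $\boldsymbol x_0$ satisfies, for some $c_1=O(\kappa^4)$, $c_2=O(\kappa^6)$ and $c_3=O(\kappa^\alpha)$, $$\mathbb E\big[F(\boldsymbol x_0^{K+1})\big]-F^*\;\le\;\frac{c_1}{(k_0+nK)^2}+\frac{c_2\cdot n^2}{(k_0+nK)^3}+\frac{c_3\cdot\|\boldsymbol x_0-\boldsymbol x^*\|^2}{(k_0+nK)^\alpha}.$$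
   Context: Setting: $n\ge2$ and $d\ge1$ are integers, $f_1,\dots,f_n:\mathbb R^d\to\mathbb R$ are differentiable, $F:=\frac1n\sum_{i=1}^n f_i$, $[a]:=\{1,\dots,a\}$, $\|\cdot\|$ is the Euclidean norm, $L,\mu>0$, $\kappa:=L/\mu$, $\boldsymbol x^*$ is the minimizer of $F$ and $F^*=F(\boldsymbol x^* )$. $C_L^1(\mathbb R^d)$ is the class of differentiable functions $h$ on $\mathbb R^d$ that are $L$-smooth: $h(\boldsymbol y)\le h(\boldsymbol x)+\langle\nabla h(\boldsymbol x),\boldsymbol y-\boldsymbol x\rangle+\frac L2\|\boldsymbol y-\boldsymbol x\|^2$ for all $\boldsymbol x,\boldsymbol y$. $F$ is $\mu$-strongly convex if $F(\boldsymbol y)\ge F(\boldsymbol x)+\langle\nabla F(\boldsymbol x),\boldsymbol y-\boldsymbol x\rangle+\frac\mu2\|\boldsymbol y-\boldsymbol x\|^2$ for all $\boldsymbol x,\boldsymbol y$. RandomShuffle: set $\boldsymbol x_0^1:=\boldsymbol x_0$. In each epoch $k=1,2,\dots$ draw a permutation $\sigma_k$ of $[n]$ uniformly at random, independently across epochs, and for $i=1,\dots,n$ set $\boldsymbol x_i^k:=\boldsymbol x_{i-1}^k-\eta_i^k\nabla f_{\sigma_k(i)}(\boldsymbol x_{i-1}^k)$; then set $\boldsymbol x_0^{k+1}:=\boldsymbol x_n^k$. The expectation is over the random permutations. Bounded iterates assumption: all the iterates $\{\boldsymbol x_1^k,\dots,\boldsymbol x_n^k\}_{k\ge1}$ are uniformly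 bounded, i.e. stay within some compact set $S\subset\mathbb R^d$ (for every realization of the permutations). Meaning of the $O$-notation: let $G$ be the maximum of $\|\nabla f_i\|$, $i\in[n]$, over the convex hull of $S\cup\{\boldsymbol x_0\}$. The paper uses the convention $\kappa=\Theta(1/\mu)$, so $L$, $G$ and $\alpha$ are treated as constants: $c_j=O(\kappa^p)$ means $c_j\le C\kappa^p$ where $C$ depends only on $L$, $G$ and $\alpha$ (not on $\mu,n,K,d$). *)

theory Defs
  imports "HOL-Probability.Probability" "HOL-Library.Poly_Mapping"
begin

text \<open>
  The constants hidden in the O-notation must not depend on the dimension d, so d has to be an
  ordinary natural number quantified inside the statement and cannot be a type.  Therefore
  Euclidean d-space is taken to be the subspace of the finitely supported sequences
  \<^typ>\<open>nat \<Rightarrow>\<^sub>0 real\<close> whose support lies in \<open>{..<d}\<close>.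
\<close>

instantiation poly_mapping :: (type, real_vector) real_vector
begin

lift_definition scaleR_poly_mapping :: "real \<Rightarrow> ('a \<Rightarrow>\<^sub>0 'b) \<Rightarrow> ('a \<Rightarrow>\<^sub>0 'b)"
  is "\<lambda>r x i. r *\<^sub>R x i"
  by (rule finite_subset) auto

instance
  by standard (rule poly_mapping_eqI,
    simp add: scaleR_poly_mapping.rep_eq lookup_add scaleR_right_distrib scaleR_left_distrib)+

end

instantiation poly_mapping :: (type, real_inner) real_inner
begin

definition inner_poly_mapping :: "('a \<Rightarrow>\<^sub>0 'b) \<Rightarrow> ('a \<Rightarrow>\<^sub>0 'b) \<Rightarrow> real" where
  "inner x y = (\<Sum>i\<in>Poly_Mapping.keys x. inner (Poly_Mapping.lookup x i) (Poly_Mapping.lookup y i))"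

definition norm_poly_mapping :: "('a \<Rightarrow>\<^sub>0 'b) \<Rightarrow> real" where
  "norm_poly_mapping x = sqrt (inner x x)"

definition sgn_poly_mapping :: "('a \<Rightarrow>\<^sub>0 'b) \<Rightarrow> ('a \<Rightarrow>\<^sub>0 'b)" where
  "sgn_poly_mapping x = x /\<^sub>R sqrt (inner x x)"

definition dist_poly_mapping :: "('a \<Rightarrow>\<^sub>0 'b) \<Rightarrow> ('a \<Rightarrow>\<^sub>0 'b) \<Rightarrow> real" where
  "dist_poly_mapping x y = sqrt (inner (x - y) (x - y))"

definition uniformity_poly_mapping :: "(('a \<Rightarrow>\<^sub>0 'b) \<times> ('a \<Rightarrow>\<^sub>0 'b)) filter" where
  "uniformity_poly_mapping = (INF e\<in>{0 <..}. principal {(x, y). sqrt (inner (x - y) (x - y)) < e})"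

definition open_poly_mapping :: "('a \<Rightarrow>\<^sub>0 'b) set \<Rightarrow> bool" where
  "open_poly_mapping U \<longleftrightarrow> (\<forall>x\<in>U. \<forall>\<^sub>F (x', y) in uniformity. x' = x \<longrightarrow> y \<in> U)"

lemma inner_poly_mapping_superset:
  fixes x y :: "'a \<Rightarrow>\<^sub>0 'b"
  assumes "finite A" "Poly_Mapping.keys x \<subseteq> A"
  shows "inner x y = (\<Sum>i\<in>A. inner (Poly_Mapping.lookup x i) (Poly_Mapping.lookup y i))"
  unfolding inner_poly_mapping_def
  using assms by (intro sum.mono_neutral_left) (auto simp: in_keys_iff)

instance
proof
  fix a b :: real and x y z :: "'a \<Rightarrow>\<^sub>0 'b"
  show "sgn x = x /\<^sub>R norm x" "dist x y = norm (x - y)" "norm x = sqrt (inner x x)"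
    by (simp_all add: sgn_poly_mapping_def dist_poly_mapping_def norm_poly_mapping_def)
  show "(uniformity :: (('a \<Rightarrow>\<^sub>0 'b) \<times> ('a \<Rightarrow>\<^sub>0 'b)) filter)
      = (INF e\<in>{0 <..}. principal {(x, y). dist x y < e})"
    by (simp add: uniformity_poly_mapping_def dist_poly_mapping_def)
  show "open U \<longleftrightarrow> (\<forall>x\<in>U. \<forall>\<^sub>F (x', y) in uniformity. x' = x \<longrightarrow> y \<in> U)"
    for U :: "('a \<Rightarrow>\<^sub>0 'b) set"
    by (rule open_poly_mapping_def)
  define A where "A = Poly_Mapping.keys x \<union> Poly_Mapping.keys y \<union> Poly_Mapping.keys z"
  have A: "finite A" "Poly_Mapping.keys x \<subseteq> A" "Poly_Mapping.keys y \<subseteq> A"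
    "Poly_Mapping.keys (x + y) \<subseteq> A" "Poly_Mapping.keys (a *\<^sub>R x) \<subseteq> A"
    by (auto simp: A_def in_keys_iff lookup_add scaleR_poly_mapping.rep_eq)
  note sup = inner_poly_mapping_superset[OF A(1)]
  show "inner x y = inner y x"
    by (simp add: sup[OF A(2)] sup[OF A(3)] inner_commute)
  show "inner (x + y) z = inner x z + inner y z"
    by (simp add: sup[OF A(2)] sup[OF A(3)] sup[OF A(4)] lookup_add inner_add_left sum.distrib)
  show "inner (a *\<^sub>R x) y = a * inner x y"
    by (simp add: sup[OF A(2)] sup[OF A(5)] scaleR_poly_mapping.rep_eq sum_distrib_left)
  show "0 \<le> inner x x"
    unfolding inner_poly_mapping_def by (intro sum_nonneg) simp
  show "inner x x = 0 \<longleftrightarrow> x = 0"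
  proof
    assume "inner x x = 0"
    then have "\<forall>i\<in>Poly_Mapping.keys x. Poly_Mapping.lookup x i = 0"
      unfolding inner_poly_mapping_def by (subst (asm) sum_nonneg_eq_0_iff) auto
    then show "x = 0"
      by (intro poly_mapping_eqI) (auto simp: in_keys_iff)
  qed (simp add: inner_poly_mapping_def)
qed

end

definition Rd :: "nat \<Rightarrow> (nat \<Rightarrow>\<^sub>0 real) set" where
  "Rd d = {x. Poly_Mapping.keys x \<subseteq> {..<d}}"

lemma subspace_Rd: "subspace (Rd d)"
proof (rule subspaceI)
  show "x + y \<in> Rd d" if "x \<in> Rd d" "y \<in> Rd d" for x y
    using that Poly_Mapping.keys_add[of x y] by (auto simp: Rd_def)
qed (auto simp: Rd_def in_keys_iff scaleR_poly_mapping.rep_eq subset_iff)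

lemma single_in_Rd: "j < d \<Longrightarrow> Poly_Mapping.single j a \<in> Rd d"
  by (auto simp: Rd_def)

lemma Rd_inner:
  assumes "x \<in> Rd d"
  shows "inner x y = (\<Sum>j<d. Poly_Mapping.lookup x j * Poly_Mapping.lookup y j)"
  using inner_poly_mapping_superset[of "{..<d}" x y] assms by (simp add: Rd_def)

lemma Rd_norm:
  assumes "x \<in> Rd d"
  shows "norm x = sqrt (\<Sum>j<d. (Poly_Mapping.lookup x j)\<^sup>2)"
  by (simp add: norm_eq_sqrt_inner Rd_inner[OF assms] power2_eq_square)

lemma Rd_expand:
  assumes "x \<in> Rd d"
  shows "x = (\<Sum>j<d. Poly_Mapping.lookup x j *\<^sub>R Poly_Mapping.single j 1)"
proof (rule poly_mapping_eqI)
  fix k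
  have "(\<Sum>j<d. Poly_Mapping.lookup x j * (1 when j = k)) = (if k < d then Poly_Mapping.lookup x k else 0)"
    by (simp add: when_def if_distrib cong: if_cong)
  also have "\<dots> = Poly_Mapping.lookup x k"
    using assms by (auto simp: Rd_def in_keys_iff subset_iff)
  finally show "Poly_Mapping.lookup x k
      = Poly_Mapping.lookup (\<Sum>j<d. Poly_Mapping.lookup x j *\<^sub>R Poly_Mapping.single j 1) k"
    by (simp add: lookup_sum scaleR_poly_mapping.rep_eq lookup_single)
qed

text \<open>
  A function on d-space is modelled by a function on all of \<^typ>\<open>nat \<Rightarrow>\<^sub>0 real\<close> whose values
  outside \<^term>\<open>Rd d\<close> are never used; in particular derivatives are taken within \<^term>\<open>Rd d\<close>.
\<close>

definition grad :: "nat \<Rightarrow> ((nat \<Rightarrow>\<^sub>0 real) \<Rightarrow> real) \<Rightarrow> (nat \<Rightarrow>\<^sub>0 real) \<Rightarrow> (nat \<Rightarrow>\<^sub>0 real)" where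
  "grad d h x = (THE g. g \<in> Rd d \<and> (h has_derivative (\<lambda>v. inner g v)) (at x within Rd d))"

lemma grad_eqI:
  assumes x: "x \<in> Rd d" and g: "g \<in> Rd d"
    and D: "(h has_derivative (\<lambda>v. inner g v)) (at x within Rd d)"
  shows "grad d h x = g"
  unfolding grad_def
proof (rule the_equality)
  fix g' assume g': "g' \<in> Rd d \<and> (h has_derivative (\<lambda>v. inner g' v)) (at x within Rd d)"
  define w where "w = g' - g"
  have w: "w \<in> Rd d"
    unfolding w_def using g g' by (intro subspace_diff[OF subspace_Rd]) auto
  have lim: "((\<lambda>y. (1 / norm (y - x)) *\<^sub>R (h y - (h x + inner a (y - x)))) \<longlongrightarrow> 0) (at x within Rd d)"
    if "(h has_derivative (\<lambda>v. inner a v)) (at x within Rd d)" for a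
    using that unfolding has_derivative_within by blast
  have "((\<lambda>y. (1 / norm (y - x)) *\<^sub>R (h y - (h x + inner g (y - x)))
      - (1 / norm (y - x)) *\<^sub>R (h y - (h x + inner g' (y - x)))) \<longlongrightarrow> 0 - 0) (at x within Rd d)"
    using D g' by (intro tendsto_diff lim) auto
  also have "(\<lambda>y. (1 / norm (y - x)) *\<^sub>R (h y - (h x + inner g (y - x)))
      - (1 / norm (y - x)) *\<^sub>R (h y - (h x + inner g' (y - x))))
      = (\<lambda>y. inner w (y - x) / norm (y - x))"
    by (rule ext) (simp add: w_def inner_diff_left diff_divide_distrib add_divide_distrib)
  finally have limw: "((\<lambda>y. inner w (y - x) / norm (y - x)) \<longlongrightarrow> 0) (at x within Rd d)"
    by simp
  have "w = 0"
  proof (rule ccontr)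
    assume "w \<noteq> 0"
    have "((\<lambda>t. x + t *\<^sub>R w) \<longlongrightarrow> x + 0 *\<^sub>R w) (at_right (0::real))"
      by (intro tendsto_intros)
    moreover have "x + t *\<^sub>R w \<in> Rd d" for t
      using x w by (intro subspace_add[OF subspace_Rd] subspace_scale[OF subspace_Rd])
    ultimately have "filterlim (\<lambda>t. x + t *\<^sub>R w) (at x within Rd d) (at_right (0::real))"
      using \<open>w \<noteq> 0\<close> by (auto simp: filterlim_at eventually_at_filter)
    from filterlim_compose[OF limw this]
    have "((\<lambda>t. inner w (t *\<^sub>R w) / norm (t *\<^sub>R w)) \<longlongrightarrow> 0) (at_right (0::real))"
      by simp
    moreover have "eventually (\<lambda>t. inner w (t *\<^sub>R w) / norm (t *\<^sub>R w) = norm w) (at_right (0::real))"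
      using \<open>w \<noteq> 0\<close>
      by (auto simp: eventually_at_filter power2_norm_eq_inner[symmetric] power2_eq_square)
    ultimately have "((\<lambda>t. norm w) \<longlongrightarrow> 0) (at_right (0::real))"
      by (rule Lim_transform_eventually)
    with \<open>w \<noteq> 0\<close> show False
      by (simp add: tendsto_const_iff)
  qed
  then show "g' = g"
    by (simp add: w_def)
qed (use assms in auto)

lemma grad_works:
  assumes x: "x \<in> Rd d" and h: "h differentiable (at x within Rd d)"
  shows "grad d h x \<in> Rd d"
    and "(h has_derivative (\<lambda>v. inner (grad d h x) v)) (at x within Rd d)"
proof -
  from h obtain D where D: "(h has_derivative D) (at x within Rd d)"
    by (auto simp: differentiable_def)
  interpret D: bounded_linear D
    using D by (rule has_derivative_bounded_linear)
  define g :: "nat \<Rightarrow>\<^sub>0 real"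
    where "g = (\<Sum>j<d. D (Poly_Mapping.single j 1) *\<^sub>R Poly_Mapping.single j 1)"
  have g: "g \<in> Rd d"
    unfolding g_def
    by (intro subspace_sum[OF subspace_Rd] subspace_scale[OF subspace_Rd] single_in_Rd) auto
  have single: "inner (Poly_Mapping.single j 1) v = Poly_Mapping.lookup v j" if "j < d"
    for j and v :: "nat \<Rightarrow>\<^sub>0 real"
    by (simp add: inner_poly_mapping_def)
  have eq: "D v = inner g v" if "v \<in> Rd d" for v
  proof -
    have "D v = D (\<Sum>j<d. Poly_Mapping.lookup v j *\<^sub>R Poly_Mapping.single j 1)"
      using Rd_expand[OF that] by simp
    also have "\<dots> = inner g v"
      by (simp add: g_def D.sum D.scaleR inner_sum_left single mult.commute)
    finally show ?thesis .
  qed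
  have "(h has_derivative (\<lambda>v. inner g v)) (at x within Rd d)"
    unfolding has_derivative_within
  proof
    show "((\<lambda>y. (1 / norm (y - x)) *\<^sub>R (h y - (h x + inner g (y - x)))) \<longlongrightarrow> 0) (at x within Rd d)"
    proof (rule Lim_transform_eventually)
      show "((\<lambda>y. (1 / norm (y - x)) *\<^sub>R (h y - (h x + D (y - x)))) \<longlongrightarrow> 0) (at x within Rd d)"
        using D by (simp add: has_derivative_within)
      show "\<forall>\<^sub>F y in at x within Rd d. (1 / norm (y - x)) *\<^sub>R (h y - (h x + D (y - x)))
          = (1 / norm (y - x)) *\<^sub>R (h y - (h x + inner g (y - x)))"
        using x by (auto simp: eventually_at_filter eq subspace_diff[OF subspace_Rd] intro!: always_eventually)
    qed
  qed (rule bounded_linear_inner_right)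
  with grad_eqI[OF x g this] g
  show "grad d h x \<in> Rd d" "(h has_derivative (\<lambda>v. inner (grad d h x) v)) (at x within Rd d)"
    by simp_all
qed

definition smooth_on_Rd :: "nat \<Rightarrow> real \<Rightarrow> ((nat \<Rightarrow>\<^sub>0 real) \<Rightarrow> real) \<Rightarrow> bool" where
  "smooth_on_Rd d L h \<longleftrightarrow> h differentiable_on Rd d \<and>
     (\<forall>x\<in>Rd d. \<forall>y\<in>Rd d. h y \<le> h x + inner (grad d h x) (y - x) + L / 2 * (norm (y - x))\<^sup>2)"

definition strongly_convex_on_Rd :: "nat \<Rightarrow> real \<Rightarrow> ((nat \<Rightarrow>\<^sub>0 real) \<Rightarrow> real) \<Rightarrow> bool" where
  "strongly_convex_on_Rd d \<mu> h \<longleftrightarrow>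
     (\<forall>x\<in>Rd d. \<forall>y\<in>Rd d. h y \<ge> h x + inner (grad d h x) (y - x) + \<mu> / 2 * (norm (y - x))\<^sup>2)"

definition quadratic_on_Rd :: "nat \<Rightarrow> ((nat \<Rightarrow>\<^sub>0 real) \<Rightarrow> real) \<Rightarrow> bool" where
  "quadratic_on_Rd d h \<longleftrightarrow> (\<exists>(A :: nat \<Rightarrow> nat \<Rightarrow> real) (b :: nat \<Rightarrow> real) (c :: real). \<forall>x\<in>Rd d.
     h x = (\<Sum>i<d. \<Sum>j<d. A i j * Poly_Mapping.lookup x i * Poly_Mapping.lookup x j)
           + (\<Sum>i<d. b i * Poly_Mapping.lookup x i) + c)"

text \<open>
  \<open>shuffle_iter d n f \<eta> \<sigma> x0 k i\<close> is the i-th iterate of epoch k, for the step sizes \<open>\<eta> k i\<close> and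
  the permutations \<open>\<sigma> k\<close>.  Epochs are numbered from 1; epoch 0 is a dummy that is
  constantly \<open>x0\<close>, so that epoch 1 starts at \<open>x0\<close>.
\<close>

fun shuffle_iter :: "nat \<Rightarrow> nat \<Rightarrow> (nat \<Rightarrow> (nat \<Rightarrow>\<^sub>0 real) \<Rightarrow> real) \<Rightarrow> (nat \<Rightarrow> nat \<Rightarrow> real) \<Rightarrow>
    (nat \<Rightarrow> nat \<Rightarrow> nat) \<Rightarrow> (nat \<Rightarrow>\<^sub>0 real) \<Rightarrow> nat \<Rightarrow> nat \<Rightarrow> (nat \<Rightarrow>\<^sub>0 real)" where
  "shuffle_iter d n f \<eta> \<sigma> x0 0 i = x0"
| "shuffle_iter d n f \<eta> \<sigma> x0 (Suc k) 0 = shuffle_iter d n f \<eta> \<sigma> x0 k n"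
| "shuffle_iter d n f \<eta> \<sigma> x0 (Suc k) (Suc i) =
     (let x = shuffle_iter d n f \<eta> \<sigma> x0 (Suc k) i
      in x - \<eta> (Suc k) (Suc i) *\<^sub>R grad d (f (\<sigma> (Suc k) (Suc i))) x)"

definition step_size :: "real \<Rightarrow> real \<Rightarrow> real \<Rightarrow> nat \<Rightarrow> nat \<Rightarrow> nat \<Rightarrow> real" where
  "step_size \<mu> \<alpha> k0 n k i =
     (if k = 1 then (2 * \<alpha> / \<mu>) / (k0 + real i) else (2 * \<alpha> / \<mu>) / (k0 + real n * real k))"

definition shuffle_pmf :: "nat \<Rightarrow> nat \<Rightarrow> (nat \<Rightarrow> nat \<Rightarrow> nat) pmf" where
  "shuffle_pmf n K = Pi_pmf {1..K} id (\<lambda>_. pmf_of_set {p. p permutes {1..n}})"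

end

theory Submission
  imports Defs
begin

text \<open>Everything is proved for the squared distance; smoothness at the minimizer turns it into
  a function gap at the cost of \<open>L / 2\<close>. The powers of \<kappa> come from the step size
  \<open>2 * \<alpha> / (\<mu> * T)\<close>, where T is the current denominator: the two epoch
  errors become multiples of \<open>\<kappa> ^ 4 * n / T ^ 3\<close> and
  \<open>\<kappa> ^ 6 * n ^ 3 / T ^ 4\<close>, and accumulating them over epochs spaced n apart
  leaves \<open>1 / T ^ 2\<close> and \<open>n ^ 2 / T ^ 3\<close>.

  Two regimes are needed because an epoch with T below
  \<open>8 * \<alpha> * \<kappa> ^ 2 * n\<close> moves too far for its gradients to be compared with
  those at its start; the second term of the claim is just large enough to pay for a cruder estimate
  there.

  The first epoch is treated step by step. Its decaying steps shrink the initial squared distance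
  like \<open>((k0 + 1) / (k0 + n + 1)) powr \<alpha>\<close>, which is the origin of
  \<open>\<kappa> powr \<alpha>\<close>. Its error is only of order
  \<open>\<kappa> ^ 4 / (k0 + n)\<close>, but \<open>k0 + n\<close> is at most a multiple of
  \<open>\<kappa> * n\<close>, so this error fits the second term after losing a further factor
  \<open>\<kappa> ^ 2\<close>.\<close>

text \<open>
  Within an epoch, averages over the permutation are compared by swapping two positions: since each
  gradient step of a convex smooth component is nonexpansive, replacing the component used at
  step \<open>j\<close> moves all later iterates by at most \<open>2 * G * \<eta> j\<close>. Hence the sampled gradient is
  unbiased up to an error of order \<open>\<eta>\<close>.

  If \<open>\<eta> * n * L * \<kappa>\<close> is small, the mean iterate follows gradient descent on the quadratic \<open>F\<close> (whose
  gradient is affine and so commutes with averaging), and the variance of the last iterate is of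
  order \<open>\<eta> ^ 4 * n ^ 3\<close> because the partial sums of shuffled gradients fluctuate like \<open>sqrt n\<close>. Otherwise
  the per-step error \<open>5 * \<eta>\<^sup>2 * G\<^sup>2\<close> is already dominated by \<open>\<kappa>\<^sup>2 * \<eta> ^ 4 * n\<^sup>2\<close>. Either way the expected squared
  distance contracts by \<open>exp (- \<alpha> * n / (k0 + n * k))\<close> up to errors of order \<open>\<kappa> * \<eta> ^ 3 * n\<close> and
  \<open>\<kappa>\<^sup>2 * \<eta> ^ 4 * n ^ 3\<close>, and a Chung-type recursion gives the claimed rate.
\<close>

section \<open>Averages over permutations\<close>

text \<open>A finite sum needs no completeness of the value space, which finitely supported
  sequences lack; this allows means of iterates as well as of numbers.
  \<open>shuffle_expectation_Suc\<close> makes the link to the random permutations.\<close>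

definition perm_avg :: "nat \<Rightarrow> ((nat \<Rightarrow> nat) \<Rightarrow> 'b::real_vector) \<Rightarrow> 'b" where
  "perm_avg n h = (\<Sum>p | p permutes {1..n}. h p) /\<^sub>R fact n"

lemma perm_avg_cong:
  "(\<And>p. p permutes {1..n} \<Longrightarrow> h p = k p) \<Longrightarrow> perm_avg n h = perm_avg n k"
  by (simp add: perm_avg_def)

lemma perm_avg_add: "perm_avg n (\<lambda>p. h p + k p) = perm_avg n h + perm_avg n k"
  by (simp add: perm_avg_def sum.distrib scaleR_add_right)

lemma perm_avg_diff: "perm_avg n (\<lambda>p. h p - k p) = perm_avg n h - perm_avg n k"
  by (simp add: perm_avg_def sum_subtractf scaleR_diff_right)

lemma perm_avg_scaleR: "perm_avg n (\<lambda>p. c *\<^sub>R h p) = c *\<^sub>R perm_avg n h"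
  by (simp add: perm_avg_def scaleR_sum_right[symmetric])

lemma perm_avg_mult: "perm_avg n (\<lambda>p. c * h p) = c * perm_avg n h" for c :: real
  using perm_avg_scaleR[of n c h] by simp

lemma perm_avg_sum: "perm_avg n (\<lambda>p. \<Sum>j\<in>J. h j p) = (\<Sum>j\<in>J. perm_avg n (h j))"
  unfolding perm_avg_def by (subst sum.swap) (rule scaleR_sum_right)

lemma perm_avg_const [simp]: "perm_avg n (\<lambda>p. c) = c"
proof -
  have "(\<Sum>p | p permutes {1..n}. c) = real (fact n) *\<^sub>R c"
    by (simp add: sum_constant_scaleR card_permutations)
  then show ?thesis
    by (simp add: perm_avg_def)
qed

lemma perm_avg_mono:
  fixes h k :: "(nat \<Rightarrow> nat) \<Rightarrow> real"
  assumes "\<And>p. p permutes {1..n} \<Longrightarrow> h p \<le> k p"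
  shows "perm_avg n h \<le> perm_avg n k"
proof -
  have "sum h {p. p permutes {1..n}} \<le> sum k {p. p permutes {1..n}}"
    using assms by (intro sum_mono) auto
  then show ?thesis
    by (simp add: perm_avg_def divide_right_mono)
qed

lemma perm_avg_nonneg:
  "(\<And>p. p permutes {1..n} \<Longrightarrow> 0 \<le> h p) \<Longrightarrow> 0 \<le> perm_avg n h" for h :: "_ \<Rightarrow> real"
  using perm_avg_mono[of n "\<lambda>_. 0" h] by simp

lemma perm_avg_le_const:
  "(\<And>p. p permutes {1..n} \<Longrightarrow> h p \<le> c) \<Longrightarrow> perm_avg n h \<le> c" for h :: "_ \<Rightarrow> real"
  using perm_avg_mono[of n h "\<lambda>_. c"] by simp

lemma norm_perm_avg_le:
  fixes h :: "(nat \<Rightarrow> nat) \<Rightarrow> 'b::real_normed_vector"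
  assumes "\<And>p. p permutes {1..n} \<Longrightarrow> norm (h p) \<le> c"
  shows "norm (perm_avg n h) \<le> c"
proof -
  have "norm (perm_avg n h) \<le> perm_avg n (\<lambda>p. norm (h p))"
    by (simp add: perm_avg_def divide_right_mono norm_sum)
  also have "\<dots> \<le> c"
    using assms by (rule perm_avg_le_const)
  finally show ?thesis .
qed

lemma linear_perm_avg:
  assumes "linear H"
  shows "H (perm_avg n X) = perm_avg n (\<lambda>p. H (X p))"
  by (simp add: perm_avg_def linear_scale[OF assms] linear_sum[OF assms])

lemma inner_perm_avg_left: "inner (perm_avg n X) c = perm_avg n (\<lambda>p. inner (X p) c)"
  by (rule linear_perm_avg) (intro bounded_linear.linear bounded_linear_inner_left)

lemma perm_avg_in_subspace:
  assumes "subspace V" "\<And>p. p permutes {1..n} \<Longrightarrow> X p \<in> V"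
  shows "perm_avg n X \<in> V"
  unfolding perm_avg_def using assms by (intro subspace_scale subspace_sum) auto

text \<open>Right composition with a transposition is a bijection of the permutations. The sampled
  index is a separate argument of \<open>h\<close>, so that on the right it is the index at position
  i while only the run that produced the iterate is altered.\<close>

lemma perm_avg_swap:
  assumes "i \<in> {1..n}" "j \<in> {1..n}"
  shows "perm_avg n (\<lambda>p. h (p j) p) = perm_avg n (\<lambda>p. h (p i) (p \<circ> Transposition.transpose i j))"
proof -
  have "Transposition.transpose i j permutes {1..n}"
    using assms by (intro permutes_swap_id)
  from sum_permutations_compose_right[OF this, of "\<lambda>p. h (p j) p"]
  show ?thesis
    by (simp add: perm_avg_def)
qed

lemma permutes_compose_transpose:
  "p permutes {1..n} \<Longrightarrow> i \<in> {1..n} \<Longrightarrow> j \<in> {1..n} \<Longrightarrow> p \<circ> Transposition.transpose i j permutes {1..n}"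
  by (intro permutes_compose permutes_swap_id)

section \<open>Norm inequalities and the variance of sampling without replacement\<close>

lemma norm_add_squared: "(norm (a + b))\<^sup>2 = (norm a)\<^sup>2 + 2 * inner a b + (norm b)\<^sup>2"
  for a b :: "'a::real_inner"
  by (simp add: power2_norm_eq_inner inner_add inner_commute)

lemma norm_diff_squared: "(norm (a - b))\<^sup>2 = (norm a)\<^sup>2 - 2 * inner a b + (norm b)\<^sup>2"
  for a b :: "'a::real_inner"
  by (simp add: power2_norm_eq_inner inner_diff inner_commute)

lemma norm_add_squared_le: "(norm (a + b))\<^sup>2 \<le> 2 * (norm a)\<^sup>2 + 2 * (norm b)\<^sup>2"
  for a b :: "'a::real_inner"
proof -
  have "0 \<le> (norm (a - b))\<^sup>2"
    by simp
  then show ?thesis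
    by (simp add: norm_add_squared norm_diff_squared)
qed

lemma norm_sum_squared_le:
  fixes v :: "'b \<Rightarrow> 'a::real_inner" and c :: "'b \<Rightarrow> real"
  assumes "\<And>j. j \<in> J \<Longrightarrow> norm (v j) \<le> c j"
  shows "(norm (\<Sum>j\<in>J. v j))\<^sup>2 \<le> card J * (\<Sum>j\<in>J. (c j)\<^sup>2)"
proof -
  have "norm (\<Sum>j\<in>J. v j) \<le> (\<Sum>j\<in>J. c j)"
    using assms by (rule sum_norm_le)
  then have "(norm (\<Sum>j\<in>J. v j))\<^sup>2 \<le> (\<Sum>j\<in>J. c j)\<^sup>2"
    by (simp add: power_mono)
  also have "\<dots> = (\<Sum>j\<in>J. 1 * c j)\<^sup>2"
    by simp
  also have "\<dots> \<le> (\<Sum>j\<in>J. 1\<^sup>2) * (\<Sum>j\<in>J. (c j)\<^sup>2)"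
    by (rule Cauchy_Schwarz_ineq_sum)
  finally show ?thesis
    by simp
qed

text \<open>Bias plus variance: the mean minimizes the mean square deviation, so any centre c may
  replace it. Later c is the end point of a full gradient step, which is easier to compare with than
  the mean iterate.\<close>

lemma perm_avg_norm_squared_le:
  fixes Z :: "(nat \<Rightarrow> nat) \<Rightarrow> 'a::real_inner"
  shows "perm_avg n (\<lambda>p. (norm (Z p))\<^sup>2)
    \<le> (norm (perm_avg n Z))\<^sup>2 + perm_avg n (\<lambda>p. (norm (Z p - c))\<^sup>2)"
proof -
  have "perm_avg n (\<lambda>p. (norm (Z p - c))\<^sup>2)
      = perm_avg n (\<lambda>p. (norm (Z p))\<^sup>2) - 2 * inner (perm_avg n Z) c + (norm c)\<^sup>2"
    by (simp add: norm_diff_squared perm_avg_add perm_avg_diff perm_avg_mult inner_perm_avg_left)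
  moreover have "0 \<le> (norm (perm_avg n Z - c))\<^sup>2"
    by simp
  ultimately show ?thesis
    unfolding norm_diff_squared by linarith
qed

lemma sum_permutes: "p permutes S \<Longrightarrow> (\<Sum>j\<in>S. h (p j)) = (\<Sum>j\<in>S. h j)"
  by (rule sum.reindex_bij_betw) (rule permutes_imp_bij)

lemma split_interval: "m \<le> n \<Longrightarrow> (\<Sum>j\<in>{1..n}. h j) = (\<Sum>j\<in>{1..m}. h j) + (\<Sum>j\<in>{Suc m..n}. h j)"
  for h :: "nat \<Rightarrow> 'b::comm_monoid_add"
proof -
  assume "m \<le> n"
  then have "{1..n} = {1..m} \<union> {Suc m..n}"
    by auto
  then show ?thesis
    by (simp add: sum.union_disjoint)
qed

text \<open>Draws without replacement from a family with sum zero are negatively correlated. By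
  symmetry each unseen position contributes the same mean inner product with the partial sum s, and
  the unseen terms add up to -s, so the cross term in the induction is at most 0.\<close>

lemma partial_sum_variance:
  fixes w :: "nat \<Rightarrow> 'a::real_inner"
  assumes zero: "(\<Sum>j\<in>{1..n}. w j) = 0" and bnd: "\<And>j. j \<in> {1..n} \<Longrightarrow> norm (w j) \<le> G"
    and "m \<le> n"
  shows "perm_avg n (\<lambda>p. (norm (\<Sum>j\<in>{1..m}. w (p j)))\<^sup>2) \<le> m * G\<^sup>2"
  using \<open>m \<le> n\<close>
proof (induction m)
  case (Suc m)
  define s where "s p = (\<Sum>j\<in>{1..m}. w (p j))" for p :: "nat \<Rightarrow> nat"
  have i: "Suc m \<in> {1..n}"
    using Suc.prems by simp
  have inv: "s (p \<circ> Transposition.transpose (Suc m) j) = s p" if "j \<in> {Suc m..n}" for p j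
    unfolding s_def using that by (intro sum.cong) (auto simp: transpose_def)
  have "(n - m) * perm_avg n (\<lambda>p. inner (s p) (w (p (Suc m))))
      = (\<Sum>j\<in>{Suc m..n}. perm_avg n (\<lambda>p. inner (s p) (w (p (Suc m)))))"
    using Suc.prems by (simp add: Suc_diff_le)
  also have "\<dots> = (\<Sum>j\<in>{Suc m..n}. perm_avg n (\<lambda>p. inner (s p) (w (p j))))"
  proof (rule sum.cong)
    fix j assume j: "j \<in> {Suc m..n}"
    then have "j \<in> {1..n}" by auto
    from perm_avg_swap[OF i this, of "\<lambda>l p. inner (s p) (w l)"]
    show "perm_avg n (\<lambda>p. inner (s p) (w (p (Suc m)))) = perm_avg n (\<lambda>p. inner (s p) (w (p j)))"
      by (simp add: inv[OF j])
  qed simp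
  also have "\<dots> = perm_avg n (\<lambda>p. inner (s p) (\<Sum>j\<in>{Suc m..n}. w (p j)))"
    by (simp add: perm_avg_sum inner_sum_right)
  also have "\<dots> = perm_avg n (\<lambda>p. - (norm (s p))\<^sup>2)"
  proof (rule perm_avg_cong)
    fix p :: "nat \<Rightarrow> nat" assume "p permutes {1..n}"
    then have "(\<Sum>j\<in>{1..n}. w (p j)) = 0"
      by (simp only: sum_permutes zero)
    then have "(\<Sum>j\<in>{Suc m..n}. w (p j)) = - s p"
      using split_interval[of m n "\<lambda>j. w (p j)"] Suc.prems
      by (simp add: s_def eq_neg_iff_add_eq_0 add.commute)
    then show "inner (s p) (\<Sum>j\<in>{Suc m..n}. w (p j)) = - (norm (s p))\<^sup>2"
      by (simp add: power2_norm_eq_inner)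
  qed
  also have "\<dots> \<le> 0"
    by (rule perm_avg_le_const) simp
  finally have neg: "perm_avg n (\<lambda>p. inner (s p) (w (p (Suc m)))) \<le> 0"
    using Suc.prems by (simp add: mult_le_0_iff)
  have "perm_avg n (\<lambda>p. (norm (w (p (Suc m))))\<^sup>2) \<le> G\<^sup>2"
  proof (rule perm_avg_le_const)
    fix p assume "p permutes {1..n}"
    then have "norm (w (p (Suc m))) \<le> G"
      using i permutes_in_image[of p "{1..n}" "Suc m"] by (intro bnd) blast
    then show "(norm (w (p (Suc m))))\<^sup>2 \<le> G\<^sup>2"
      by (intro power_mono) auto
  qed
  moreover have "(\<Sum>j\<in>{1..Suc m}. w (p j)) = s p + w (p (Suc m))" for p
    by (simp add: s_def)
  moreover have "perm_avg n (\<lambda>p. (norm (s p))\<^sup>2) \<le> m * G\<^sup>2"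
    unfolding s_def using Suc by simp
  ultimately show ?case
    using neg by (simp add: norm_add_squared perm_avg_add perm_avg_mult algebra_simps)
qed simp

section \<open>Gradient steps of convex smooth components\<close>

primrec gd_run :: "(nat \<Rightarrow> 'a \<Rightarrow> 'a) \<Rightarrow> (nat \<Rightarrow> real) \<Rightarrow> (nat \<Rightarrow> nat) \<Rightarrow> 'a \<Rightarrow> nat \<Rightarrow> 'a::real_vector" where
  "gd_run g \<eta> p x 0 = x"
| "gd_run g \<eta> p x (Suc i) = gd_run g \<eta> p x i - \<eta> (Suc i) *\<^sub>R g (p (Suc i)) (gd_run g \<eta> p x i)"

text \<open>Only the two first-order inequalities of the gradients are kept, so the analysis of an
  epoch is free of derivatives. \<open>V\<close> will be \<open>Rd d\<close>.\<close>

locale smooth_convex_sum =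
  fixes V :: "'a::real_inner set" and f :: "nat \<Rightarrow> 'a \<Rightarrow> real" and g :: "nat \<Rightarrow> 'a \<Rightarrow> 'a"
    and n :: nat and L :: real
  assumes subspace_V: "subspace V" and L_pos: "L > 0" and n_pos: "n > 0"
    and g_in_V: "\<And>i x. i \<in> {1..n} \<Longrightarrow> x \<in> V \<Longrightarrow> g i x \<in> V"
    and convex_below: "\<And>i x y. i \<in> {1..n} \<Longrightarrow> x \<in> V \<Longrightarrow> y \<in> V \<Longrightarrow>
      f i y \<ge> f i x + inner (g i x) (y - x)"
    and smooth_above: "\<And>i x y. i \<in> {1..n} \<Longrightarrow> x \<in> V \<Longrightarrow> y \<in> V \<Longrightarrow>
      f i y \<le> f i x + inner (g i x) (y - x) + L / 2 * (norm (y - x))\<^sup>2"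
begin

text \<open>The Bregman divergence of \<open>f i\<close> based at y is nonnegative and smooth, with
  gradient \<open>w\<close> at x. A step of length \<open>1 / L\<close> from x to z lowers it by at
  least the right-hand side, and it cannot fall below 0.\<close>

lemma bregman_lower:
  assumes i: "i \<in> {1..n}" and x: "x \<in> V" and y: "y \<in> V"
  shows "f i x - f i y - inner (g i y) (x - y) \<ge> (norm (g i x - g i y))\<^sup>2 / (2 * L)"
proof -
  define w where "w = g i x - g i y"
  define z where "z = x - (1 / L) *\<^sub>R w"
  have "z \<in> V"
    unfolding z_def w_def using g_in_V[OF i] x y
    by (intro subspace_diff[OF subspace_V] subspace_scale[OF subspace_V]) auto
  then have "f i y + inner (g i y) (z - y) \<le> f i x + inner (g i x) (z - x) + L / 2 * (norm (z - x))\<^sup>2"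
    using convex_below[OF i y, of z] smooth_above[OF i x, of z] by linarith
  moreover have "inner (g i y) (z - y) = inner (g i y) (x - y) - inner (g i y) w / L"
    by (simp add: z_def inner_diff_right)
  moreover have "inner (g i x) (z - x) = - inner (g i x) w / L"
    by (simp add: z_def)
  moreover have "L / 2 * (norm (z - x))\<^sup>2 = inner w w / (2 * L)"
    using L_pos by (simp add: z_def power_mult_distrib power_divide power2_eq_square[of L] flip: power2_norm_eq_inner)
  moreover have "inner (g i x) w = inner w w + inner (g i y) w"
    by (simp add: w_def inner_diff_left)
  then have "- inner (g i x) w / L + inner (g i y) w / L = - inner w w / L"
    by (simp add: add_divide_distrib diff_divide_distrib)
  ultimately show ?thesis
    by (simp add: power2_norm_eq_inner flip: w_def)
qed

lemma cocoercive:
  assumes i: "i \<in> {1..n}" and x: "x \<in> V" and y: "y \<in> V"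
  shows "(norm (g i x - g i y))\<^sup>2 \<le> L * inner (g i x - g i y) (x - y)"
proof -
  have "(norm (g i x - g i y))\<^sup>2 / (2 * L) + (norm (g i y - g i x))\<^sup>2 / (2 * L)
      \<le> inner (g i x - g i y) (x - y)"
    using bregman_lower[OF i x y] bregman_lower[OF i y x] by (simp add: inner_diff)
  then show ?thesis
    using L_pos by (simp add: norm_minus_commute field_simps)
qed

lemma lipschitz:
  assumes "i \<in> {1..n}" "x \<in> V" "y \<in> V"
  shows "norm (g i x - g i y) \<le> L * norm (x - y)"
proof -
  have "norm (g i x - g i y) * norm (g i x - g i y) \<le> L * inner (g i x - g i y) (x - y)"
    using cocoercive[OF assms] by (simp add: power2_eq_square)
  also have "\<dots> \<le> L * (norm (g i x - g i y) * norm (x - y))"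
    using L_pos norm_cauchy_schwarz[of "g i x - g i y" "x - y"] by simp
  finally have "norm (g i x - g i y) * norm (g i x - g i y) \<le> norm (g i x - g i y) * (L * norm (x - y))"
    by (simp add: mult_ac)
  then show ?thesis
    using L_pos by (cases "norm (g i x - g i y) = 0") (auto simp: mult_le_cancel_left)
qed

lemma step_nonexpansive:
  assumes "i \<in> {1..n}" "x \<in> V" "y \<in> V" and t: "0 \<le> t" "t \<le> 2 / L"
  shows "norm ((x - t *\<^sub>R g i x) - (y - t *\<^sub>R g i y)) \<le> norm (x - y)"
proof -
  define w where "w = g i x - g i y"
  have co: "(norm w)\<^sup>2 \<le> L * inner w (x - y)"
    unfolding w_def by (rule cocoercive) fact+
  then have pos: "0 \<le> inner w (x - y)"
    using L_pos order_trans[OF zero_le_power2 co] by (simp add: zero_le_mult_iff)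
  have "(norm ((x - y) - t *\<^sub>R w))\<^sup>2 = (norm (x - y))\<^sup>2 - 2 * t * inner w (x - y) + t * t * (norm w)\<^sup>2"
    by (simp add: norm_diff_squared inner_commute power_mult_distrib power2_eq_square[of t])
  also have "t * t * (norm w)\<^sup>2 \<le> t * t * (L * inner w (x - y))"
    using co t by (intro mult_left_mono) auto
  \<comment> \<open>Cocoercivity prices the quadratic term in units of the linear one;
    \<open>2 / L\<close> is the largest t for which the linear term still pays.\<close>
  also have "\<dots> \<le> t * (2 / L) * (L * inner w (x - y))"
    using pos t L_pos by (intro mult_right_mono mult_left_mono) auto
  also have "\<dots> = 2 * t * inner w (x - y)"
    using L_pos by simp
  finally have "(norm ((x - y) - t *\<^sub>R w))\<^sup>2 \<le> (norm (x - y))\<^sup>2"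
    by simp
  then have "norm ((x - y) - t *\<^sub>R w) \<le> norm (x - y)"
    by (rule power2_le_imp_le) simp
  moreover have "(x - t *\<^sub>R g i x) - (y - t *\<^sub>R g i y) = (x - y) - t *\<^sub>R w"
    by (simp add: w_def scaleR_diff_right)
  ultimately show ?thesis
    by metis
qed

lemma gd_run_in_V:
  assumes "p permutes {1..n}" "x \<in> V" "i \<le> n"
  shows "gd_run g \<eta> p x i \<in> V"
  using \<open>i \<le> n\<close>
proof (induction i)
  case (Suc i)
  then have "p (Suc i) \<in> {1..n}"
    using permutes_in_image[OF assms(1), of "Suc i"] by simp
  then show ?case
    using Suc by (auto intro!: subspace_diff[OF subspace_V] subspace_scale[OF subspace_V] g_in_V)
qed (use assms in simp)

text \<open>Stability: a swap of a later index into position \<open>j\<close> perturbs the run at step \<open>j\<close> only,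
  and all further steps are nonexpansive.\<close>

lemma gd_run_swap:
  assumes p: "p permutes {1..n}" and x: "x \<in> V" and j: "j \<in> {1..n}" and k: "k \<in> {1..n}"
    and i: "i < k" "i < n"
    and steps: "\<And>l. l \<in> {1..n} \<Longrightarrow> 0 \<le> \<eta> l \<and> \<eta> l \<le> 2 / L"
    and bnd: "\<And>p l i. p permutes {1..n} \<Longrightarrow> l \<in> {1..n} \<Longrightarrow> i < n \<Longrightarrow> norm (g l (gd_run g \<eta> p x i)) \<le> G"
  shows "norm (gd_run g \<eta> (p \<circ> Transposition.transpose k j) x i - gd_run g \<eta> p x i)
    \<le> (if j \<le> i then 2 * G * \<eta> j else 0)"
proof -
  define q where "q = p \<circ> Transposition.transpose k j"
  have q: "q permutes {1..n}"
    unfolding q_def using p k j by (rule permutes_compose_transpose)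
  have eq: "q l = p l" if "l \<noteq> j" "l \<noteq> k" for l
    using that by (simp add: q_def)
  show ?thesis
    using i unfolding q_def[symmetric]
  proof (induction i)
    case (Suc i)
    define X where "X = gd_run g \<eta> p x i"
    define Y where "Y = gd_run g \<eta> q x i"
    have XY: "X \<in> V" "Y \<in> V"
      unfolding X_def Y_def using Suc.prems by (auto intro!: gd_run_in_V p q x)
    have pin: "p (Suc i) \<in> {1..n}" and qin: "q (Suc i) \<in> {1..n}"
      using Suc.prems permutes_in_image[OF p, of "Suc i"] permutes_in_image[OF q, of "Suc i"] by auto
    have st: "0 \<le> \<eta> (Suc i)" "\<eta> (Suc i) \<le> 2 / L"
      using steps[of "Suc i"] Suc.prems by auto
    have IH: "norm (Y - X) \<le> (if j \<le> i then 2 * G * \<eta> j else 0)"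
      using Suc unfolding X_def Y_def by simp
    show ?case
    proof (cases "Suc i = j")
      case True
      then have "Y = X"
        using IH by simp
      then have "norm (gd_run g \<eta> q x (Suc i) - gd_run g \<eta> p x (Suc i))
          = norm (\<eta> (Suc i) *\<^sub>R (g (p (Suc i)) X - g (q (Suc i)) X))"
        by (simp add: X_def Y_def scaleR_diff_right)
      also have "\<dots> = \<eta> (Suc i) * norm (g (p (Suc i)) X - g (q (Suc i)) X)"
        using st by simp
      also have "\<dots> \<le> \<eta> (Suc i) * (G + G)"
        unfolding X_def using Suc.prems st
        by (intro mult_left_mono order_trans[OF norm_triangle_ineq4] add_mono bnd p pin qin) auto
      finally show ?thesis
        using True by (simp add: algebra_simps)
    next
      case False
      then have "q (Suc i) = p (Suc i)"
        using Suc.prems by (intro eq) auto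
      then have "norm (gd_run g \<eta> q x (Suc i) - gd_run g \<eta> p x (Suc i))
          = norm ((Y - \<eta> (Suc i) *\<^sub>R g (p (Suc i)) Y) - (X - \<eta> (Suc i) *\<^sub>R g (p (Suc i)) X))"
        by (simp add: X_def Y_def)
      also have "\<dots> \<le> norm (Y - X)"
        by (intro step_nonexpansive pin XY st)
      finally show ?thesis
        using IH False by (simp split: if_splits)
    qed
  qed (use j in simp)
qed

end

locale strongly_convex_sum = smooth_convex_sum V f g n L
  for V :: "'a::real_inner set" and f g n L +
  fixes \<mu> :: real and xs :: 'a
  assumes mu_pos: "\<mu> > 0" and mu_le: "\<mu> \<le> L" and xs: "xs \<in> V"
    and grad_xs: "(\<Sum>i\<in>{1..n}. g i xs) = 0"
    and strong: "\<And>x y. x \<in> V \<Longrightarrow> y \<in> V \<Longrightarrow> (\<Sum>i\<in>{1..n}. f i y)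
      \<ge> (\<Sum>i\<in>{1..n}. f i x) + inner (\<Sum>i\<in>{1..n}. g i x) (y - x) + n * \<mu> / 2 * (norm (y - x))\<^sup>2"
begin

lemma growth: "y \<in> V \<Longrightarrow> (\<Sum>i\<in>{1..n}. f i y - f i xs) \<ge> n * \<mu> / 2 * (norm (y - xs))\<^sup>2"
  using strong[OF xs, of y] unfolding grad_xs by (simp add: sum_subtractf)

lemma monotone_grad:
  assumes "y \<in> V"
  shows "inner (\<Sum>i\<in>{1..n}. g i y) (y - xs) \<ge> n * \<mu> * (norm (y - xs))\<^sup>2"
  using strong[OF xs assms] strong[OF assms xs] unfolding grad_xs
  by (simp add: inner_diff_right norm_minus_commute)

text \<open>The minimizer may lie outside the region where G bounds the gradients. Strong
  monotonicity places it within \<open>G / \<mu>\<close> of any point x that has the bound, and the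
  Lipschitz property transports the bound, at the cost of a factor of order \<kappa>.\<close>

lemma grad_at_minimizer:
  assumes x: "x \<in> V" and bnd: "\<And>i. i \<in> {1..n} \<Longrightarrow> norm (g i x) \<le> G" and i: "i \<in> {1..n}"
  shows "norm (g i xs) \<le> (1 + L / \<mu>) * G"
proof -
  define D where "D = norm (x - xs)"
  have "n * \<mu> * D\<^sup>2 \<le> norm (\<Sum>i\<in>{1..n}. g i x) * D"
    unfolding D_def using monotone_grad[OF x] norm_cauchy_schwarz order_trans by blast
  also have "norm (\<Sum>i\<in>{1..n}. g i x) \<le> (\<Sum>i\<in>{1..n}. G)"
    by (rule sum_norm_le) (rule bnd)
  finally have "n * \<mu> * D\<^sup>2 \<le> n * G * D"
    by (simp add: D_def mult_right_mono)
  then have "real n * (D * (\<mu> * D)) \<le> real n * (D * G)"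
    by (simp add: power2_eq_square mult_ac)
  then have "D * (\<mu> * D) \<le> D * G"
    using n_pos by simp
  moreover have "0 \<le> G"
    using bnd[OF i] norm_ge_zero order_trans by blast
  ultimately have "\<mu> * D \<le> G"
    by (cases "D = 0") (auto simp: D_def mult_le_cancel_left)
  then have "D \<le> G / \<mu>"
    using mu_pos by (simp add: field_simps)
  moreover have "norm (g i xs) \<le> norm (g i x) + norm (g i x - g i xs)"
    by (metis norm_minus_commute norm_triangle_sub)
  ultimately have "norm (g i xs) \<le> G + L * (G / \<mu>)"
    using bnd[OF i] lipschitz[OF i x xs] mult_left_mono[of D "G / \<mu>" L] L_pos
    unfolding D_def by linarith
  then show ?thesis
    by (simp add: algebra_simps)
qed

end

section \<open>One step of a shuffled epoch\<close>

text \<open>The bound G is required for every component at the iterates of every permutation: after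
  a swap, a component is evaluated on a run that did not sample it at that time.\<close>

locale shuffled_epoch = strongly_convex_sum V f g n L \<mu> xs
  for V :: "'a::real_inner set" and f g n L \<mu> xs +
  fixes \<eta> :: "nat \<Rightarrow> real" and x :: 'a and G :: real
  assumes start: "x \<in> V"
    and steps: "\<And>l. l \<in> {1..n} \<Longrightarrow> 0 \<le> \<eta> l \<and> \<eta> l \<le> 2 / L"
    and grad_bound: "\<And>p l i. p permutes {1..n} \<Longrightarrow> l \<in> {1..n} \<Longrightarrow> i < n \<Longrightarrow>
      norm (g l (gd_run g \<eta> p x i)) \<le> G"
begin

abbreviation X :: "(nat \<Rightarrow> nat) \<Rightarrow> nat \<Rightarrow> 'a" where
  "X p i \<equiv> gd_run g \<eta> p x i"

definition D :: "nat \<Rightarrow> real" where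
  "D i = perm_avg n (\<lambda>p. (norm (X p i - xs))\<^sup>2)"

lemma X_in_V: "p permutes {1..n} \<Longrightarrow> i \<le> n \<Longrightarrow> X p i \<in> V"
  by (intro gd_run_in_V start)

lemma G_nonneg: "0 \<le> G"
proof -
  have "norm (g 1 (X id 0)) \<le> G"
    using n_pos by (intro grad_bound permutes_id) auto
  then show ?thesis
    using norm_ge_zero order_trans by blast
qed

lemma swap_stable:
  assumes "p permutes {1..n}" "j \<in> {1..n}" "i < n"
  shows "norm (X (p \<circ> Transposition.transpose (Suc i) j) i - X p i) \<le> (if j \<le> i then 2 * G * \<eta> j else 0)"
  using assms by (intro gd_run_swap start steps grad_bound) auto

lemma X_eq_sum: "X p i = x - (\<Sum>j\<in>{1..i}. \<eta> j *\<^sub>R g (p j) (X p (j - 1)))"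
  by (induction i) (simp_all add: algebra_simps)

text \<open>The cut \<open>m\<close> trades two ways of controlling the bias. A position j between m
  and i is compared with the sampled position by a swap, which costs a multiple of
  \<open>\<eta> j\<close>; positions beyond i are free, since the iterate does not depend on their
  order. The first m components are instead removed from the full sum, and what they contribute is
  governed by a partial sum of gradients at the minimizer, which has small variance.
  \<open>m = 0\<close> is pure stability.\<close>

lemma expected_step:
  assumes i: "i < n" and m: "m \<le> i" "4 * L * m \<le> n * \<mu>"
    and Gs: "\<And>j. j \<in> {1..n} \<Longrightarrow> norm (g j xs) \<le> Gs"
  shows "D (Suc i) \<le> (1 - \<eta> (Suc i) * \<mu> / 2) * D i + (\<eta> (Suc i))\<^sup>2 * G\<^sup>2
    + 2 * \<eta> (Suc i) * (8 * real m * Gs\<^sup>2 / (\<mu> * n\<^sup>2) + 2 * G\<^sup>2 / (real n - real m) * (\<Sum>j\<in>{Suc m..i}. \<eta> j))"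
proof -
  define t where "t = \<eta> (Suc i)"
  define \<phi> where "\<phi> l y = f l y - f l xs" for l y
  define s where "s p = (\<Sum>j\<in>{1..m}. g (p j) xs)" for p :: "nat \<Rightarrow> nat"
  define N where "N = real n - real m"
  define \<Phi> where "\<Phi> = perm_avg n (\<lambda>p. \<phi> (p (Suc i)) (X p i))"
  define S where "S = (\<Sum>j\<in>{Suc m..i}. \<eta> j)"
  have Si: "Suc i \<in> {1..n}"
    using i by simp
  have t: "0 \<le> t"
    unfolding t_def using steps[OF Si] by simp
  have N_pos: "N > 0"
    using i m by (simp add: N_def)
  have pin: "p j \<in> {1..n}" if "p permutes {1..n}" "j \<in> {1..n}" for p j
    by (simp only: permutes_in_image[OF that(1)] that)

  have "D (Suc i) \<le> perm_avg n (\<lambda>p. (norm (X p i - xs))\<^sup>2 - 2 * t * \<phi> (p (Suc i)) (X p i) + t\<^sup>2 * G\<^sup>2)"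
    unfolding D_def
  proof (rule perm_avg_mono)
    fix p assume p: "p permutes {1..n}"
    define v where "v = g (p (Suc i)) (X p i)"
    have "norm v \<le> G"
      unfolding v_def by (rule grad_bound[OF p pin[OF p Si] i])
    then have "(norm v)\<^sup>2 \<le> G\<^sup>2"
      by (rule power_mono) simp
    then have "t\<^sup>2 * (norm v)\<^sup>2 \<le> t\<^sup>2 * G\<^sup>2"
      by (intro mult_left_mono) auto
    moreover have "\<phi> (p (Suc i)) (X p i) \<le> inner v (X p i - xs)"
      using convex_below[OF pin[OF p Si] X_in_V[OF p, of i] xs] i
      by (simp add: \<phi>_def v_def inner_diff_right)
    then have "t * \<phi> (p (Suc i)) (X p i) \<le> t * inner v (X p i - xs)"
      using t by (rule mult_left_mono)
    moreover have "(norm ((X p i - xs) - t *\<^sub>R v))\<^sup>2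
        = (norm (X p i - xs))\<^sup>2 - 2 * (t * inner v (X p i - xs)) + t\<^sup>2 * (norm v)\<^sup>2"
      by (simp add: norm_diff_squared inner_commute power_mult_distrib)
    moreover have eq: "X p (Suc i) - xs = (X p i - xs) - t *\<^sub>R v"
      by (simp add: t_def v_def)
    ultimately show "(norm (X p (Suc i) - xs))\<^sup>2
        \<le> (norm (X p i - xs))\<^sup>2 - 2 * t * \<phi> (p (Suc i)) (X p i) + t\<^sup>2 * G\<^sup>2"
      unfolding eq mult.assoc by linarith
  qed
  also have "\<dots> = D i - 2 * t * \<Phi> + t\<^sup>2 * G\<^sup>2"
    by (simp only: perm_avg_add perm_avg_diff perm_avg_mult perm_avg_const D_def \<Phi>_def)
  finally have step: "D (Suc i) \<le> D i - 2 * t * \<Phi> + t\<^sup>2 * G\<^sup>2" .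

  \<comment> \<open>Convexity at the perturbed iterate bounds the change of the function value by G
    times the displacement, and the displacement by stability.\<close>
  have swapped: "perm_avg n (\<lambda>p. \<phi> (p j) (X p i)) \<le> \<Phi> + (if j \<le> i then 2 * G\<^sup>2 * \<eta> j else 0)"
    if j: "j \<in> {Suc m..n}" for j
  proof -
    have j1: "j \<in> {1..n}"
      using j by simp
    have "perm_avg n (\<lambda>p. \<phi> (p j) (X p i))
        = perm_avg n (\<lambda>p. \<phi> (p (Suc i)) (X (p \<circ> Transposition.transpose (Suc i) j) i))"
      by (rule perm_avg_swap[OF Si j1])
    also have "\<dots> \<le> perm_avg n (\<lambda>p. \<phi> (p (Suc i)) (X p i) + (if j \<le> i then 2 * G\<^sup>2 * \<eta> j else 0))"
    proof (rule perm_avg_mono)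
      fix p assume p: "p permutes {1..n}"
      define Y where "Y = X (p \<circ> Transposition.transpose (Suc i) j) i"
      have q: "p \<circ> Transposition.transpose (Suc i) j permutes {1..n}"
        using p Si j1 by (rule permutes_compose_transpose)
      have "\<phi> (p (Suc i)) Y - \<phi> (p (Suc i)) (X p i) \<le> inner (g (p (Suc i)) Y) (Y - X p i)"
        using convex_below[OF pin[OF p Si] X_in_V[OF q, of i] X_in_V[OF p, of i]] i
        by (simp add: \<phi>_def Y_def inner_diff_right)
      also have "\<dots> \<le> norm (g (p (Suc i)) Y) * norm (Y - X p i)"
        by (rule norm_cauchy_schwarz)
      also have "\<dots> \<le> G * (if j \<le> i then 2 * G * \<eta> j else 0)"
        unfolding Y_def using grad_bound[OF q pin[OF p Si] i] swap_stable[OF p j1 i] G_nonneg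
        by (intro mult_mono) auto
      also have "\<dots> = (if j \<le> i then 2 * G\<^sup>2 * \<eta> j else 0)"
        by (simp add: power2_eq_square)
      finally show "\<phi> (p (Suc i)) (X (p \<circ> Transposition.transpose (Suc i) j) i)
          \<le> \<phi> (p (Suc i)) (X p i) + (if j \<le> i then 2 * G\<^sup>2 * \<eta> j else 0)"
        by (simp add: Y_def)
    qed
    also have "\<dots> = \<Phi> + (if j \<le> i then 2 * G\<^sup>2 * \<eta> j else 0)"
      by (simp only: perm_avg_add perm_avg_const \<Phi>_def)
    finally show ?thesis .
  qed

  \<comment> \<open>The growth of the full sum minus an upper bound for the first m components,
    whose smoothness error is at most \<open>m * L / 2\<close> times the squared distance.\<close>
  have pointwise: "(\<Sum>j\<in>{Suc m..n}. \<phi> (p j) (X p i))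
      \<ge> N * \<mu> / 4 * (norm (X p i - xs))\<^sup>2 - 2 / (N * \<mu>) * (norm (s p))\<^sup>2"
    if p: "p permutes {1..n}" for p
  proof -
    define d where "d = norm (X p i - xs)"
    have XV: "X p i \<in> V"
      using p i by (intro X_in_V) auto
    have "n * \<mu> / 2 * d\<^sup>2 \<le> (\<Sum>j\<in>{1..n}. \<phi> j (X p i))"
      unfolding d_def \<phi>_def using XV by (rule growth)
    also have "\<dots> = (\<Sum>j\<in>{1..n}. \<phi> (p j) (X p i))"
      by (rule sum_permutes[OF p, symmetric])
    also have "\<dots> = (\<Sum>j\<in>{1..m}. \<phi> (p j) (X p i)) + (\<Sum>j\<in>{Suc m..n}. \<phi> (p j) (X p i))"
      using i m by (intro split_interval) auto
    also have "(\<Sum>j\<in>{1..m}. \<phi> (p j) (X p i)) \<le> (\<Sum>j\<in>{1..m}. inner (g (p j) xs) (X p i - xs) + L / 2 * d\<^sup>2)"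
    proof (rule sum_mono)
      fix j assume "j \<in> {1..m}"
      then have "p j \<in> {1..n}"
        using i m by (intro pin[OF p]) auto
      from smooth_above[OF this xs XV]
      show "\<phi> (p j) (X p i) \<le> inner (g (p j) xs) (X p i - xs) + L / 2 * d\<^sup>2"
        by (simp add: \<phi>_def d_def)
    qed
    also have "\<dots> = inner (s p) (X p i - xs) + m * (L / 2 * d\<^sup>2)"
      by (simp add: s_def sum.distrib inner_sum_left)
    also have "inner (s p) (X p i - xs) \<le> norm (s p) * d"
      unfolding d_def by (rule norm_cauchy_schwarz)
    \<comment> \<open>Young's inequality with its weight fixed by the budget: growth gives
      \<open>n * \<mu> / 2\<close>, smoothness takes at most \<open>n * \<mu> / 8\<close> by the
      condition on m, this step takes \<open>N * \<mu> / 8\<close>, and \<open>N * \<mu> / 4\<close>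
      must remain.\<close>
    also have "norm (s p) * d \<le> N * \<mu> / 8 * d\<^sup>2 + 2 / (N * \<mu>) * (norm (s p))\<^sup>2"
    proof -
      have "0 \<le> (N * \<mu> * d - 4 * norm (s p))\<^sup>2 / (8 * (N * \<mu>))"
        using N_pos mu_pos by simp
      also have "\<dots> = N * \<mu> / 8 * d\<^sup>2 + 2 / (N * \<mu>) * (norm (s p))\<^sup>2 - norm (s p) * d"
        using N_pos mu_pos by (simp add: power2_diff power_mult_distrib divide_simps power2_eq_square) (simp add: algebra_simps)
      finally show ?thesis by simp
    qed
    finally have "n * \<mu> / 2 * d\<^sup>2 - m * (L / 2 * d\<^sup>2) - N * \<mu> / 8 * d\<^sup>2 - 2 / (N * \<mu>) * (norm (s p))\<^sup>2
        \<le> (\<Sum>j\<in>{Suc m..n}. \<phi> (p j) (X p i))"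
      by simp
    moreover have "N * \<mu> / 4 * d\<^sup>2 \<le> (n * \<mu> / 2 - m * (L / 2) - N * \<mu> / 8) * d\<^sup>2"
    proof (rule mult_right_mono)
      have "0 \<le> m * \<mu>"
        using mu_pos by simp
      then show "N * \<mu> / 4 \<le> n * \<mu> / 2 - m * (L / 2) - N * \<mu> / 8"
        using m(2) by (simp add: N_def algebra_simps add_divide_distrib diff_divide_distrib)
    qed simp
    ultimately show ?thesis
      by (simp add: d_def algebra_simps)
  qed

  have variance: "perm_avg n (\<lambda>p. (norm (s p))\<^sup>2) \<le> m * Gs\<^sup>2"
    unfolding s_def using i m Gs by (intro partial_sum_variance grad_xs) auto
  have "N * \<mu> / 4 * D i - 2 / (N * \<mu>) * (m * Gs\<^sup>2)
      \<le> N * \<mu> / 4 * D i - 2 / (N * \<mu>) * perm_avg n (\<lambda>p. (norm (s p))\<^sup>2)"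
    using variance N_pos mu_pos by (intro diff_left_mono mult_left_mono) auto
  also have "\<dots> = perm_avg n (\<lambda>p. N * \<mu> / 4 * (norm (X p i - xs))\<^sup>2 - 2 / (N * \<mu>) * (norm (s p))\<^sup>2)"
    by (simp only: perm_avg_diff perm_avg_mult D_def)
  also have "\<dots> \<le> perm_avg n (\<lambda>p. \<Sum>j\<in>{Suc m..n}. \<phi> (p j) (X p i))"
    by (rule perm_avg_mono) (rule pointwise)
  also have "\<dots> = (\<Sum>j\<in>{Suc m..n}. perm_avg n (\<lambda>p. \<phi> (p j) (X p i)))"
    by (rule perm_avg_sum)
  also have "\<dots> \<le> (\<Sum>j\<in>{Suc m..n}. \<Phi> + (if j \<le> i then 2 * G\<^sup>2 * \<eta> j else 0))"
    by (rule sum_mono) (rule swapped)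
  also have "\<dots> = N * \<Phi> + (\<Sum>j\<in>{Suc m..n}. if j \<le> i then 2 * G\<^sup>2 * \<eta> j else 0)"
    using i m by (simp add: sum.distrib N_def of_nat_diff)
  also have "(\<Sum>j\<in>{Suc m..n}. if j \<le> i then 2 * G\<^sup>2 * \<eta> j else 0) = (\<Sum>j\<in>{Suc m..i}. 2 * G\<^sup>2 * \<eta> j)"
    using i by (intro sum.mono_neutral_cong_right) auto
  also have "\<dots> = 2 * G\<^sup>2 * S"
    by (simp add: S_def sum_distrib_left)
  finally have "(N * \<mu> / 4 * D i - 2 / (N * \<mu>) * (m * Gs\<^sup>2) - 2 * G\<^sup>2 * S) / N \<le> \<Phi>"
    using N_pos by (simp add: pos_divide_le_eq mult.commute)
  also have "(N * \<mu> / 4 * D i - 2 / (N * \<mu>) * (m * Gs\<^sup>2) - 2 * G\<^sup>2 * S) / N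
      = \<mu> / 4 * D i - 2 * real m * Gs\<^sup>2 / (\<mu> * N\<^sup>2) - 2 * G\<^sup>2 / N * S"
    using N_pos by (simp add: diff_divide_distrib power2_eq_square mult_ac)
  finally have "\<mu> / 4 * D i - 2 * real m * Gs\<^sup>2 / (\<mu> * N\<^sup>2) - 2 * G\<^sup>2 / N * S \<le> \<Phi>" .
  moreover have "2 * real m * Gs\<^sup>2 / (\<mu> * N\<^sup>2) \<le> 8 * real m * Gs\<^sup>2 / (\<mu> * n\<^sup>2)"
  proof -
    have "4 * L * m \<le> n * L"
      using m(2) mult_left_mono[OF mu_le, of n] by simp
    then have "4 * real m \<le> n"
      using L_pos by (simp add: mult.commute)
    then have "n / 2 \<le> N"
      by (simp add: N_def)
    then have "(n / 2)\<^sup>2 \<le> N\<^sup>2"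
      by (rule power_mono) simp
    then have "2 * real m * Gs\<^sup>2 / (\<mu> * N\<^sup>2) \<le> 2 * real m * Gs\<^sup>2 / (\<mu> * (n / 2)\<^sup>2)"
      using mu_pos n_pos N_pos by (intro divide_left_mono mult_left_mono mult_pos_pos) auto
    also have "\<dots> = 8 * real m * Gs\<^sup>2 / (\<mu> * n\<^sup>2)"
      by (simp add: power_divide)
    finally show ?thesis .
  qed
  moreover define e where "e = 8 * real m * Gs\<^sup>2 / (\<mu> * n\<^sup>2) + 2 * G\<^sup>2 / N * S"
  ultimately have "\<mu> / 4 * D i - e \<le> \<Phi>"
    by linarith
  then have "2 * t * (\<mu> / 4 * D i - e) \<le> 2 * t * \<Phi>"
    using t by (intro mult_left_mono) auto
  with step have "D (Suc i) \<le> (1 - t * \<mu> / 2) * D i + t\<^sup>2 * G\<^sup>2 + 2 * t * e"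
    by (simp add: algebra_simps)
  then show ?thesis
    by (simp only: e_def t_def S_def N_def)
qed

end

section \<open>Epochs with small constant step size\<close>

text \<open>With \<open>s = t * \<mu> * n\<close>, the mean iterate contracts by
  \<open>exp (- s)\<close> in squared norm. The factor \<open>1 + s / 4\<close> comes from
  separating the bias, and \<open>s / 8\<close> from the part of the variance that is proportional
  to the initial squared distance; half of the exponent pays for both.\<close>

lemma exp_half_step:
  fixes s :: real
  assumes "0 \<le> s" "s \<le> 1 / 4"
  shows "(1 + s / 4) * exp (- s) + s / 8 \<le> exp (- (s / 2))"
proof -
  define E where "E = exp (- (3 * s / 4))"
  have "1 / 2 \<le> 1 + (- (3 * s / 4))"
    using assms by simp
  also have "\<dots> \<le> E"
    unfolding E_def by (rule exp_ge_add_one_self)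
  finally have "1 / 2 * (s / 4) \<le> E * (s / 4)"
    using assms by (intro mult_right_mono) auto
  have "(1 + s / 4) * exp (- s) \<le> exp (s / 4) * exp (- s)"
    by (intro mult_right_mono exp_ge_add_one_self) auto
  also have "\<dots> = E"
    by (simp add: E_def flip: exp_add)
  finally have "(1 + s / 4) * exp (- s) + s / 8 \<le> E + E * (s / 4)"
    using \<open>1 / 2 * (s / 4) \<le> E * (s / 4)\<close> by simp
  also have "\<dots> = E * (1 + s / 4)"
    by (simp add: algebra_simps)
  also have "\<dots> \<le> E * exp (s / 4)"
    by (intro mult_left_mono exp_ge_add_one_self) (simp add: E_def)
  also have "\<dots> = exp (- (s / 2))"
    by (simp add: E_def flip: exp_add)
  finally show ?thesis .
qed

lemma add_squared_le:
  fixes a b s :: real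
  assumes "s > 0"
  shows "(a + b)\<^sup>2 \<le> (1 + s) * a\<^sup>2 + (1 + 1 / s) * b\<^sup>2"
proof -
  have "0 \<le> (s * a - b)\<^sup>2 / s"
    using assms by simp
  also have "\<dots> = (1 + s) * a\<^sup>2 + (1 + 1 / s) * b\<^sup>2 - (a + b)\<^sup>2"
    using assms by (simp add: field_simps power2_eq_square)
  finally show ?thesis
    by simp
qed

text \<open>\<open>H\<close> is the Hessian of the quadratic average. The condition
  \<open>small\<close> says \<open>4 * t * n * L * \<kappa> \<le> 1\<close> with
  \<open>\<kappa> = L / \<mu>\<close>; it makes \<open>(t * n * L) ^ 2\<close> at most a quarter of
  the contraction exponent \<open>t * \<mu> * n\<close>.\<close>

locale constant_step_epoch = shuffled_epoch V f g n L \<mu> xs \<eta> x G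
  for V :: "'a::real_inner set" and f g n L \<mu> xs \<eta> x G +
  fixes H :: "'a \<Rightarrow> 'a" and t :: real
  assumes H: "linear H" and grad_eq: "\<And>y. y \<in> V \<Longrightarrow> (\<Sum>i\<in>{1..n}. g i y) = real n *\<^sub>R H (y - xs)"
    and const: "\<And>l. l \<in> {1..n} \<Longrightarrow> \<eta> l = t" and t_pos: "t > 0"
    and small: "4 * (t * n * L) * L \<le> \<mu>"
begin

lemma tL_le: "t * n * L \<le> 1 / 4"
proof -
  have "4 * (t * n * L) * L \<le> 1 * L"
    using small mu_le by simp
  then show ?thesis
    using L_pos by (simp del: mult_1_left)
qed

text \<open>Inherited from the components by Cauchy-Schwarz; it takes the place of symmetry and a
  spectral bound for \<open>H\<close>.\<close>

lemma cocoercive_H: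
  assumes y: "y \<in> V"
  shows "(norm (H (y - xs)))\<^sup>2 \<le> L * inner (H (y - xs)) (y - xs)"
proof -
  define h where "h = H (y - xs)"
  define v where "v i = g i y - g i xs" for i
  have sum_v: "(\<Sum>i\<in>{1..n}. v i) = real n *\<^sub>R h"
    using grad_eq[OF y] grad_xs by (simp add: v_def sum_subtractf h_def)
  have "(norm (\<Sum>i\<in>{1..n}. v i))\<^sup>2 \<le> card {1..n} * (\<Sum>i\<in>{1..n}. (norm (v i))\<^sup>2)"
    by (rule norm_sum_squared_le) simp
  also have "\<dots> \<le> card {1..n} * (\<Sum>i\<in>{1..n}. L * inner (v i) (y - xs))"
    unfolding v_def by (intro mult_left_mono sum_mono cocoercive y xs) auto
  also have "\<dots> = n * (L * inner (\<Sum>i\<in>{1..n}. v i) (y - xs))"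
    by (simp add: sum_distrib_left inner_sum_left)
  finally have "(real n)\<^sup>2 * (norm h)\<^sup>2 \<le> (real n)\<^sup>2 * (L * inner h (y - xs))"
    unfolding sum_v by (simp add: power_mult_distrib power2_eq_square[of "real n"] mult_ac)
  then show ?thesis
    using n_pos by (simp add: h_def)
qed

lemma norm_H_le:
  assumes y: "y \<in> V"
  shows "norm (H (y - xs)) \<le> L * norm (y - xs)"
proof -
  have "norm (H (y - xs)) * norm (H (y - xs)) \<le> L * inner (H (y - xs)) (y - xs)"
    using cocoercive_H[OF y] by (simp add: power2_eq_square)
  also have "\<dots> \<le> L * (norm (H (y - xs)) * norm (y - xs))"
    using L_pos by (intro mult_left_mono norm_cauchy_schwarz) auto
  finally have "norm (H (y - xs)) * norm (H (y - xs)) \<le> norm (H (y - xs)) * (L * norm (y - xs))"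
    by (simp add: mult_ac)
  then show ?thesis
    using L_pos by (cases "norm (H (y - xs)) = 0") (auto simp: mult_le_cancel_left)
qed

text \<open>For \<open>t * L \<le> 1\<close> cocoercivity gives back half of the linear term, which
  leaves \<open>1 - t * \<mu>\<close> for the squared norm. The square root suffices, as the bound
  is squared again after n steps.\<close>

lemma full_gradient_contracts:
  assumes y: "y \<in> V"
  shows "norm ((y - xs) - t *\<^sub>R H (y - xs)) \<le> sqrt (1 - t * \<mu>) * norm (y - xs)"
proof -
  define h where "h = H (y - xs)"
  define d where "d = y - xs"
  have "n * \<mu> * (norm d)\<^sup>2 \<le> n * inner h d"
    using monotone_grad[OF y] unfolding grad_eq[OF y] by (simp add: h_def d_def)
  then have mono: "\<mu> * (norm d)\<^sup>2 \<le> inner h d"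
    using n_pos by (simp add: mult.assoc)
  have "t * L \<le> 1"
  proof -
    have "1 * (t * L) \<le> n * (t * L)"
      using n_pos t_pos L_pos by (intro mult_right_mono) auto
    then show ?thesis
      using tL_le by (simp add: mult_ac)
  qed
  moreover have "0 \<le> inner h d"
    using mono mu_pos by (intro order_trans[OF _ mono]) simp
  ultimately have "t * L * inner h d \<le> 1 * inner h d"
    by (rule mult_right_mono)
  moreover have "t * (norm h)\<^sup>2 \<le> t * (L * inner h d)"
    using cocoercive_H[OF y] t_pos by (simp add: h_def d_def)
  ultimately have "t * (norm h)\<^sup>2 \<le> inner h d"
    unfolding mult.assoc by linarith
  then have "t * (t * (norm h)\<^sup>2) \<le> t * inner h d"
    using t_pos by (intro mult_left_mono) auto
  moreover have "t * (\<mu> * (norm d)\<^sup>2) \<le> t * inner h d"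
    using mono t_pos by (intro mult_left_mono) auto
  moreover have "(norm (d - t *\<^sub>R h))\<^sup>2 = (norm d)\<^sup>2 - 2 * (t * inner h d) + t * (t * (norm h)\<^sup>2)"
    by (simp add: norm_diff_squared inner_commute power_mult_distrib power2_eq_square[of t])
  ultimately have "(norm (d - t *\<^sub>R h))\<^sup>2 \<le> (1 - t * \<mu>) * (norm d)\<^sup>2"
    by (simp add: algebra_simps)
  then have "sqrt ((norm (d - t *\<^sub>R h))\<^sup>2) \<le> sqrt ((1 - t * \<mu>) * (norm d)\<^sup>2)"
    by (rule real_sqrt_le_mono)
  then show ?thesis
    by (simp add: real_sqrt_mult h_def d_def)
qed

text \<open>The mean iterate follows gradient descent on the full sum up to the stability error, because
  averaging commutes with the affine full gradient.\<close>

lemma mean_step: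
  assumes i: "i < n"
  shows "norm (perm_avg n (\<lambda>p. X p (Suc i)) - xs)
    \<le> sqrt (1 - t * \<mu>) * norm (perm_avg n (\<lambda>p. X p i) - xs) + 2 * L * G * t\<^sup>2"
proof -
  define M where "M = perm_avg n (\<lambda>p. X p i)"
  define A where "A = H (M - xs)"
  define B where "B = perm_avg n (\<lambda>p. g (p (Suc i)) (X p i))"
  have Si: "Suc i \<in> {1..n}"
    using i by simp
  have MV: "M \<in> V"
    unfolding M_def using i by (intro perm_avg_in_subspace subspace_V X_in_V) auto
  have "M - xs = perm_avg n (\<lambda>p. X p i - xs)"
    by (simp add: M_def perm_avg_diff)
  then have "real n *\<^sub>R A = perm_avg n (\<lambda>p. real n *\<^sub>R H (X p i - xs))"
    by (simp add: A_def linear_perm_avg[OF H] perm_avg_scaleR)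
  also have "\<dots> = perm_avg n (\<lambda>p. \<Sum>j\<in>{1..n}. g (p j) (X p i))"
  proof (rule perm_avg_cong)
    fix p assume p: "p permutes {1..n}"
    show "real n *\<^sub>R H (X p i - xs) = (\<Sum>j\<in>{1..n}. g (p j) (X p i))"
      unfolding sum_permutes[OF p, of "\<lambda>j. g j (X p i)"]
      using i by (intro grad_eq[symmetric] X_in_V p) auto
  qed
  also have "\<dots> = (\<Sum>j\<in>{1..n}. perm_avg n (\<lambda>p. g (p j) (X p i)))"
    by (rule perm_avg_sum)
  also have "\<dots> = (\<Sum>j\<in>{1..n}. perm_avg n (\<lambda>p. g (p (Suc i)) (X (p \<circ> Transposition.transpose (Suc i) j) i)))"
    by (intro sum.cong perm_avg_swap Si refl)
  finally have "real n *\<^sub>R (A - B) = (\<Sum>j\<in>{1..n}. perm_avg n (\<lambda>p.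
      g (p (Suc i)) (X (p \<circ> Transposition.transpose (Suc i) j) i) - g (p (Suc i)) (X p i)))"
    by (simp add: scaleR_diff_right perm_avg_diff sum_subtractf B_def sum_constant_scaleR)
  then have "norm (real n *\<^sub>R (A - B)) \<le> (\<Sum>j\<in>{1..n}. L * (2 * G * t))"
  proof (simp only:, intro sum_norm_le norm_perm_avg_le)
    fix p j assume j: "j \<in> {1..n}" and p: "p permutes {1..n}"
    have q: "p \<circ> Transposition.transpose (Suc i) j permutes {1..n}"
      using p Si j by (rule permutes_compose_transpose)
    have "norm (g (p (Suc i)) (X (p \<circ> Transposition.transpose (Suc i) j) i) - g (p (Suc i)) (X p i))
        \<le> L * norm (X (p \<circ> Transposition.transpose (Suc i) j) i - X p i)"
      using i by (intro lipschitz X_in_V p q) (auto simp only: permutes_in_image[OF p] Si)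
    also have "norm (X (p \<circ> Transposition.transpose (Suc i) j) i - X p i) \<le> (if j \<le> i then 2 * G * \<eta> j else 0)"
      by (rule swap_stable[OF p j i])
    also have "\<dots> \<le> 2 * G * t"
      using const[OF j] G_nonneg t_pos by simp
    finally show "norm (g (p (Suc i)) (X (p \<circ> Transposition.transpose (Suc i) j) i) - g (p (Suc i)) (X p i))
        \<le> L * (2 * G * t)"
      using L_pos by simp
  qed
  then have "real n * norm (A - B) \<le> real n * (L * (2 * G * t))"
    by simp
  then have AB: "norm (A - B) \<le> L * (2 * G * t)"
    using n_pos by simp
  have "perm_avg n (\<lambda>p. X p (Suc i)) = M - t *\<^sub>R B"
    by (simp add: perm_avg_diff perm_avg_scaleR M_def B_def const[OF Si])
  then have "perm_avg n (\<lambda>p. X p (Suc i)) - xs = ((M - xs) - t *\<^sub>R A) + t *\<^sub>R (A - B)"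
    by (simp add: algebra_simps)
  then have "norm (perm_avg n (\<lambda>p. X p (Suc i)) - xs) \<le> norm ((M - xs) - t *\<^sub>R A) + norm (t *\<^sub>R (A - B))"
    by (simp only: norm_triangle_ineq)
  also have "norm (t *\<^sub>R (A - B)) \<le> t * (L * (2 * G * t))"
    using AB t_pos by simp
  also have "norm ((M - xs) - t *\<^sub>R A) \<le> sqrt (1 - t * \<mu>) * norm (M - xs)"
    unfolding A_def by (rule full_gradient_contracts[OF MV])
  finally show ?thesis
    by (simp add: M_def power2_eq_square mult_ac)
qed

lemma t_mu: "t * \<mu> \<le> 1"
proof -
  have "t * \<mu> \<le> 1 * (t * L)"
    using mu_le t_pos by simp
  also have "\<dots> \<le> n * (t * L)"
    using n_pos t_pos L_pos by (intro mult_right_mono) auto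
  finally show ?thesis
    using tL_le by (simp add: mult_ac)
qed

lemma mean_bound:
  assumes "i \<le> n"
  shows "norm (perm_avg n (\<lambda>p. X p i) - xs)
    \<le> sqrt (1 - t * \<mu>) ^ i * norm (x - xs) + i * (2 * L * G * t\<^sup>2)"
  using assms
proof (induction i)
  case (Suc i)
  define r where "r = sqrt (1 - t * \<mu>)"
  define \<beta> where "\<beta> = 2 * L * G * t\<^sup>2"
  have r: "0 \<le> r" "r \<le> 1"
    using t_mu t_pos mu_pos by (auto simp: r_def)
  have \<beta>: "0 \<le> \<beta>"
    using G_nonneg L_pos by (simp add: \<beta>_def)
  have "norm (perm_avg n (\<lambda>p. X p (Suc i)) - xs) \<le> r * norm (perm_avg n (\<lambda>p. X p i) - xs) + \<beta>"
    unfolding r_def \<beta>_def using Suc.prems by (intro mean_step) simp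
  also have "r * norm (perm_avg n (\<lambda>p. X p i) - xs) \<le> r * (r ^ i * norm (x - xs) + i * \<beta>)"
    unfolding r_def \<beta>_def using Suc t_mu by (intro mult_left_mono) auto
  also have "\<dots> = r ^ Suc i * norm (x - xs) + r * (i * \<beta>)"
    by (simp add: algebra_simps)
  also have "r * (i * \<beta>) \<le> 1 * (i * \<beta>)"
    using r \<beta> by (intro mult_right_mono) auto
  finally show ?case
    by (simp add: r_def \<beta>_def algebra_simps)
qed simp

text \<open>This is \<open>2 * t ^ 2\<close> times the bound of
  \<open>fixed_point_partial_sum\<close>: the share of the mean square displacement caused by
  gradients frozen at x, with the factor 2 of splitting a square.\<close>

definition drift :: real where
  "drift = 4 * t\<^sup>2 * n\<^sup>2 * L\<^sup>2 * (norm (x - xs))\<^sup>2 + 16 * t\<^sup>2 * n * G\<^sup>2"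

text \<open>The gradients are frozen at x. Their common mean h is at most L times the distance to
  the minimizer, and the centred parts fluctuate as draws without replacement, so G enters with n
  and not with its square.\<close>

lemma fixed_point_partial_sum:
  assumes "i \<le> n"
  shows "perm_avg n (\<lambda>p. (norm (\<Sum>j\<in>{1..i}. g (p j) x))\<^sup>2)
    \<le> 2 * n\<^sup>2 * L\<^sup>2 * (norm (x - xs))\<^sup>2 + 8 * n * G\<^sup>2"
proof -
  define h where "h = H (x - xs)"
  define w where "w j = g j x - h" for j
  have bx: "norm (g j x) \<le> G" if "j \<in> {1..n}" for j
    using grad_bound[OF permutes_id that, of 0] n_pos by simp
  have sum_g: "(\<Sum>j\<in>{1..n}. g j x) = real n *\<^sub>R h"
    using grad_eq[OF start] by (simp add: h_def)
  then have sum_w: "(\<Sum>j\<in>{1..n}. w j) = 0"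
    by (simp add: w_def sum_subtractf sum_constant_scaleR)
  have "norm (real n *\<^sub>R h) \<le> (\<Sum>j\<in>{1..n}. G)"
    unfolding sum_g[symmetric] by (rule sum_norm_le) (rule bx)
  then have h_G: "norm h \<le> G"
    using n_pos by simp
  have "norm (w j) \<le> 2 * G" if "j \<in> {1..n}" for j
    using norm_triangle_ineq4[of "g j x" h] bx[OF that] h_G by (simp add: w_def)
  then have "perm_avg n (\<lambda>p. (norm (\<Sum>j\<in>{1..i}. w (p j)))\<^sup>2) \<le> i * (2 * G)\<^sup>2"
    using assms by (intro partial_sum_variance sum_w) auto
  also have "\<dots> \<le> n * (2 * G)\<^sup>2"
    using assms by (intro mult_right_mono) auto
  finally have var: "perm_avg n (\<lambda>p. (norm (\<Sum>j\<in>{1..i}. w (p j)))\<^sup>2) \<le> 4 * n * G\<^sup>2"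
    by (simp add: power_mult_distrib)
  have "(norm (real i *\<^sub>R h))\<^sup>2 = (i * norm h)\<^sup>2"
    by simp
  also have "\<dots> \<le> (n * (L * norm (x - xs)))\<^sup>2"
    using assms norm_H_le[OF start] by (intro power_mono mult_mono) (auto simp: h_def)
  finally have mean: "(norm (real i *\<^sub>R h))\<^sup>2 \<le> n\<^sup>2 * L\<^sup>2 * (norm (x - xs))\<^sup>2"
    by (simp add: power_mult_distrib mult.assoc)
  have "perm_avg n (\<lambda>p. (norm (\<Sum>j\<in>{1..i}. g (p j) x))\<^sup>2)
      \<le> perm_avg n (\<lambda>p. 2 * (norm (real i *\<^sub>R h))\<^sup>2 + 2 * (norm (\<Sum>j\<in>{1..i}. w (p j)))\<^sup>2)"
  proof (rule perm_avg_mono)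
    fix p :: "nat \<Rightarrow> nat"
    have "(\<Sum>j\<in>{1..i}. g (p j) x) = real i *\<^sub>R h + (\<Sum>j\<in>{1..i}. w (p j))"
      by (simp add: w_def sum_subtractf sum_constant_scaleR)
    then show "(norm (\<Sum>j\<in>{1..i}. g (p j) x))\<^sup>2
        \<le> 2 * (norm (real i *\<^sub>R h))\<^sup>2 + 2 * (norm (\<Sum>j\<in>{1..i}. w (p j)))\<^sup>2"
      by (simp only: norm_add_squared_le)
  qed
  also have "\<dots> = 2 * (norm (real i *\<^sub>R h))\<^sup>2 + 2 * perm_avg n (\<lambda>p. (norm (\<Sum>j\<in>{1..i}. w (p j)))\<^sup>2)"
    by (simp only: perm_avg_add perm_avg_mult perm_avg_const)
  finally show ?thesis
    using mean var by simp
qed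

lemma deviation_sum:
  assumes i: "i \<le> n" and "0 \<le> K" and K: "\<And>j. j < i \<Longrightarrow> perm_avg n (\<lambda>p. (norm (X p j - x))\<^sup>2) \<le> K"
  shows "perm_avg n (\<lambda>p. (norm (\<Sum>j\<in>{1..i}. g (p j) (X p (j - 1)) - g (p j) x))\<^sup>2) \<le> n\<^sup>2 * L\<^sup>2 * K"
proof -
  have "perm_avg n (\<lambda>p. (norm (\<Sum>j\<in>{1..i}. g (p j) (X p (j - 1)) - g (p j) x))\<^sup>2)
      \<le> perm_avg n (\<lambda>p. i * (\<Sum>j\<in>{1..i}. L\<^sup>2 * (norm (X p (j - 1) - x))\<^sup>2))"
  proof (rule perm_avg_mono)
    fix p assume p: "p permutes {1..n}"
    have "(norm (\<Sum>j\<in>{1..i}. g (p j) (X p (j - 1)) - g (p j) x))\<^sup>2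
        \<le> card {1..i} * (\<Sum>j\<in>{1..i}. (L * norm (X p (j - 1) - x))\<^sup>2)"
    proof (rule norm_sum_squared_le)
      fix j assume j: "j \<in> {1..i}"
      then have "j \<in> {1..n}"
        using i by auto
      then have "p j \<in> {1..n}"
        by (simp only: permutes_in_image[OF p])
      then show "norm (g (p j) (X p (j - 1)) - g (p j) x) \<le> L * norm (X p (j - 1) - x)"
        using j i by (intro lipschitz X_in_V p start) auto
    qed
    then show "(norm (\<Sum>j\<in>{1..i}. g (p j) (X p (j - 1)) - g (p j) x))\<^sup>2
        \<le> i * (\<Sum>j\<in>{1..i}. L\<^sup>2 * (norm (X p (j - 1) - x))\<^sup>2)"
      by (simp add: power_mult_distrib)
  qed
  also have "\<dots> = i * (\<Sum>j\<in>{1..i}. L\<^sup>2 * perm_avg n (\<lambda>p. (norm (X p (j - 1) - x))\<^sup>2))"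
    by (simp only: perm_avg_mult perm_avg_sum)
  also have "\<dots> \<le> i * (\<Sum>j\<in>{1..i}. L\<^sup>2 * K)"
    by (intro mult_left_mono sum_mono K) auto
  also have "\<dots> = i\<^sup>2 * (L\<^sup>2 * K)"
    by (simp add: power2_eq_square)
  also have "\<dots> \<le> n\<^sup>2 * (L\<^sup>2 * K)"
    using i \<open>0 \<le> K\<close> by (intro mult_right_mono) auto
  finally show ?thesis
    by (simp add: mult.assoc)
qed

lemma deviation_bound:
  assumes "i \<le> n"
  shows "perm_avg n (\<lambda>p. (norm (X p i - x))\<^sup>2) \<le> 2 * drift"
  using assms
proof (induction i rule: less_induct)
  case (less i)
  define a where "a p = (\<Sum>j\<in>{1..i}. g (p j) x)" for p :: "nat \<Rightarrow> nat"
  define b where "b p = (\<Sum>j\<in>{1..i}. g (p j) (X p (j - 1)) - g (p j) x)" for p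
  have drift: "0 \<le> drift"
    by (simp add: drift_def)
  have a: "perm_avg n (\<lambda>p. (norm (a p))\<^sup>2) \<le> 2 * n\<^sup>2 * L\<^sup>2 * (norm (x - xs))\<^sup>2 + 8 * n * G\<^sup>2"
    unfolding a_def using less.prems by (rule fixed_point_partial_sum)
  have b: "perm_avg n (\<lambda>p. (norm (b p))\<^sup>2) \<le> n\<^sup>2 * L\<^sup>2 * (2 * drift)"
    unfolding b_def using less drift by (intro deviation_sum) auto
  have "perm_avg n (\<lambda>p. (norm (X p i - x))\<^sup>2)
      \<le> perm_avg n (\<lambda>p. (2 * t\<^sup>2) * (norm (a p))\<^sup>2 + (2 * t\<^sup>2) * (norm (b p))\<^sup>2)"
  proof (rule perm_avg_mono)
    fix p assume p: "p permutes {1..n}"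
    have "(\<Sum>j\<in>{1..i}. \<eta> j *\<^sub>R g (p j) (X p (j - 1))) = (\<Sum>j\<in>{1..i}. t *\<^sub>R g (p j) (X p (j - 1)))"
      using less.prems by (intro sum.cong) (auto simp: const)
    also have "\<dots> = t *\<^sub>R (a p + b p)"
      by (simp add: a_def b_def sum_subtractf scaleR_sum_right)
    finally have "X p i - x = - (t *\<^sub>R (a p + b p))"
      using X_eq_sum[of p i] by simp
    then have "(norm (X p i - x))\<^sup>2 = t\<^sup>2 * (norm (a p + b p))\<^sup>2"
      by (simp add: power_mult_distrib del: scaleR_add_right)
    also have "\<dots> \<le> t\<^sup>2 * (2 * (norm (a p))\<^sup>2 + 2 * (norm (b p))\<^sup>2)"
      by (intro mult_left_mono norm_add_squared_le) auto
    finally show "(norm (X p i - x))\<^sup>2 \<le> (2 * t\<^sup>2) * (norm (a p))\<^sup>2 + (2 * t\<^sup>2) * (norm (b p))\<^sup>2"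
      by (simp add: algebra_simps)
  qed
  also have "\<dots> = (2 * t\<^sup>2) * perm_avg n (\<lambda>p. (norm (a p))\<^sup>2) + (2 * t\<^sup>2) * perm_avg n (\<lambda>p. (norm (b p))\<^sup>2)"
    by (simp only: perm_avg_add perm_avg_mult)
  also have "\<dots> \<le> (2 * t\<^sup>2) * (2 * n\<^sup>2 * L\<^sup>2 * (norm (x - xs))\<^sup>2 + 8 * n * G\<^sup>2) + (2 * t\<^sup>2) * (n\<^sup>2 * L\<^sup>2 * (2 * drift))"
    using a b by (intro add_mono mult_left_mono) auto
  also have "\<dots> = drift + 4 * (t * n * L)\<^sup>2 * drift"
    by (simp add: drift_def power_mult_distrib algebra_simps)
  also have "\<dots> \<le> 2 * drift"
  proof -
    have "(t * n * L)\<^sup>2 \<le> (1 / 4)\<^sup>2"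
      using tL_le t_pos L_pos by (intro power_mono) auto
    then have "4 * (t * n * L)\<^sup>2 * drift \<le> 1 * drift"
      using drift by (intro mult_right_mono) (auto simp: power2_eq_square)
    then show ?thesis
      by simp
  qed
  finally show ?case .
qed

text \<open>A complete epoch uses every component once, so with gradients frozen at x its end point
  would not depend on the order: it would be this centre, a full gradient step of length
  \<open>t * n\<close>. Only the change of the gradients along the run remains.\<close>

lemma final_deviation:
  "perm_avg n (\<lambda>p. (norm ((X p n - xs) - ((x - xs) - t *\<^sub>R (real n *\<^sub>R H (x - xs)))))\<^sup>2)
    \<le> 2 * t\<^sup>2 * n\<^sup>2 * L\<^sup>2 * drift"
proof -
  define b where "b p = (\<Sum>j\<in>{1..n}. g (p j) (X p (j - 1)) - g (p j) x)" for p
  have drift: "0 \<le> drift"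
    by (simp add: drift_def)
  have "perm_avg n (\<lambda>p. (norm ((X p n - xs) - ((x - xs) - t *\<^sub>R (real n *\<^sub>R H (x - xs)))))\<^sup>2)
      = perm_avg n (\<lambda>p. t\<^sup>2 * (norm (b p))\<^sup>2)"
  proof (rule perm_avg_cong)
    fix p assume p: "p permutes {1..n}"
    have "(\<Sum>j\<in>{1..n}. g (p j) x) = real n *\<^sub>R H (x - xs)"
      using sum_permutes[OF p, of "\<lambda>j. g j x"] grad_eq[OF start] by simp
    then have b: "b p = (\<Sum>j\<in>{1..n}. g (p j) (X p (j - 1))) - real n *\<^sub>R H (x - xs)"
      by (simp only: b_def sum_subtractf)
    have "(\<Sum>j\<in>{1..n}. \<eta> j *\<^sub>R g (p j) (X p (j - 1))) = (\<Sum>j\<in>{1..n}. t *\<^sub>R g (p j) (X p (j - 1)))"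
      by (intro sum.cong) (auto simp: const)
    then have "X p n = x - t *\<^sub>R (\<Sum>j\<in>{1..n}. g (p j) (X p (j - 1)))"
      using X_eq_sum[of p n] by (simp only: scaleR_sum_right)
    then have "(X p n - xs) - ((x - xs) - t *\<^sub>R (real n *\<^sub>R H (x - xs))) = - (t *\<^sub>R b p)"
      unfolding b by (simp add: scaleR_diff_right)
    then show "(norm ((X p n - xs) - ((x - xs) - t *\<^sub>R (real n *\<^sub>R H (x - xs)))))\<^sup>2 = t\<^sup>2 * (norm (b p))\<^sup>2"
      by (simp only: norm_minus_cancel norm_scaleR power_mult_distrib power2_abs)
  qed
  also have "\<dots> = t\<^sup>2 * perm_avg n (\<lambda>p. (norm (b p))\<^sup>2)"
    by (rule perm_avg_mult)
  also have "\<dots> \<le> t\<^sup>2 * (n\<^sup>2 * L\<^sup>2 * (2 * drift))"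
    unfolding b_def using drift by (intro mult_left_mono deviation_sum deviation_bound) auto
  finally show ?thesis
    by (simp add: mult_ac)
qed

lemma constant_step_epoch_bound:
  "D n \<le> exp (- (t * \<mu> * n / 2)) * (norm (x - xs))\<^sup>2
    + 20 * L\<^sup>2 * G\<^sup>2 / \<mu> * t ^ 3 * n + 32 * L\<^sup>2 * G\<^sup>2 * t ^ 4 * n ^ 3"
proof -
  define d where "d = norm (x - xs)"
  define s where "s = t * \<mu> * n"
  define u where "u = t * n * L"
  define b where "b = n * (2 * L * G * t\<^sup>2)"
  define a where "a = sqrt (1 - t * \<mu>) ^ n * d"
  have s: "0 < s"
    using t_pos mu_pos n_pos by (simp add: s_def)
  have u: "0 \<le> u" "u \<le> 1 / 4"
    using tL_le t_pos L_pos by (simp_all add: u_def)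
  have "s \<le> u"
    using mu_le t_pos by (simp add: s_def u_def mult_right_mono mult_ac)
  then have s4: "s \<le> 1 / 4"
    using u by simp
  have uu: "u * u \<le> s / 4"
  proof -
    have "4 * (u * L) * (t * n) \<le> \<mu> * (t * n)"
      using small t_pos unfolding u_def by (intro mult_right_mono) auto
    then show ?thesis
      by (simp add: s_def u_def mult_ac)
  qed
  have "D n \<le> (norm (perm_avg n (\<lambda>p. X p n - xs)))\<^sup>2
      + perm_avg n (\<lambda>p. (norm ((X p n - xs) - ((x - xs) - t *\<^sub>R (real n *\<^sub>R H (x - xs)))))\<^sup>2)"
    unfolding D_def by (rule perm_avg_norm_squared_le)
  also have "\<dots> \<le> (norm (perm_avg n (\<lambda>p. X p n - xs)))\<^sup>2 + 2 * t\<^sup>2 * n\<^sup>2 * L\<^sup>2 * drift"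
    by (intro add_left_mono final_deviation)
  also have "\<dots> = (norm (perm_avg n (\<lambda>p. X p n) - xs))\<^sup>2 + 2 * u\<^sup>2 * drift"
    by (simp add: perm_avg_diff u_def power_mult_distrib)
  also have "\<dots> \<le> (a + b)\<^sup>2 + 2 * u\<^sup>2 * drift"
    unfolding a_def b_def d_def by (intro add_right_mono power_mono mean_bound) auto
  also have "\<dots> \<le> ((1 + s / 4) * a\<^sup>2 + (1 + 1 / (s / 4)) * b\<^sup>2) + 2 * u\<^sup>2 * drift"
    using s by (intro add_right_mono add_squared_le) auto
  finally have D: "D n \<le> (1 + s / 4) * a\<^sup>2 + (1 + 4 / s) * b\<^sup>2 + 2 * u\<^sup>2 * drift"
    by simp

  have "a\<^sup>2 = (1 - t * \<mu>) ^ n * d\<^sup>2"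
    using t_mu by (simp add: a_def power_mult_distrib power2_eq_square flip: power_mult_distrib)
  also have "(1 - t * \<mu>) ^ n \<le> exp (- (t * \<mu>)) ^ n"
    using t_mu exp_ge_add_one_self[of "- (t * \<mu>)"] by (intro power_mono) auto
  also have "exp (- (t * \<mu>)) ^ n = exp (- s)"
    by (simp add: s_def mult_ac flip: exp_of_nat_mult)
  finally have "a\<^sup>2 \<le> exp (- s) * d\<^sup>2"
    by (simp add: mult_right_mono)
  then have A: "(1 + s / 4) * a\<^sup>2 \<le> (1 + s / 4) * (exp (- s) * d\<^sup>2)"
    using s by (intro mult_left_mono) auto
  \<comment> \<open>The squared bias is of order \<open>t ^ 4 * n ^ 2\<close>; dividing it by
    \<open>s = t * \<mu> * n\<close> produces the error of order
    \<open>t ^ 3 * n / \<mu>\<close>.\<close>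
  have "(1 + 4 / s) * b\<^sup>2 \<le> 5 / s * b\<^sup>2"
    using s s4 by (intro mult_right_mono) (auto simp: field_simps)
  also have "\<dots> = 20 * L\<^sup>2 * G\<^sup>2 / \<mu> * t ^ 3 * n"
    using s t_pos mu_pos n_pos by (simp add: s_def b_def field_simps power2_eq_square power3_eq_cube)
  finally have B: "(1 + 4 / s) * b\<^sup>2 \<le> 20 * L\<^sup>2 * G\<^sup>2 / \<mu> * t ^ 3 * n" .
  \<comment> \<open>The distance part of the drift is of fourth order in u. One factor
    \<open>u * u\<close> is at most 1/16 and the other at most \<open>s / 4\<close>, so it is
    charged to the contraction.\<close>
  have C: "2 * u\<^sup>2 * drift \<le> s / 8 * d\<^sup>2 + 32 * L\<^sup>2 * G\<^sup>2 * t ^ 4 * n ^ 3"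
  proof -
    have "2 * u\<^sup>2 * drift = 8 * (u * u) * (u * u) * d\<^sup>2 + 32 * L\<^sup>2 * G\<^sup>2 * t ^ 4 * n ^ 3"
      by (simp add: drift_def u_def d_def algebra_simps power2_eq_square power3_eq_cube power4_eq_xxxx)
    moreover have "(u * u) * (u * u) \<le> (1 / 4 * (1 / 4)) * (s / 4)"
      using u uu by (intro mult_mono) auto
    then have "8 * (u * u) * (u * u) * d\<^sup>2 \<le> s / 8 * d\<^sup>2"
      by (intro mult_right_mono) auto
    ultimately show ?thesis
      by simp
  qed
  have "((1 + s / 4) * exp (- s) + s / 8) * d\<^sup>2 \<le> exp (- (s / 2)) * d\<^sup>2"
    using s s4 by (intro mult_right_mono exp_half_step) auto
  then have "D n \<le> exp (- (s / 2)) * d\<^sup>2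
    + 20 * L\<^sup>2 * G\<^sup>2 / \<mu> * t ^ 3 * n + 32 * L\<^sup>2 * G\<^sup>2 * t ^ 4 * n ^ 3"
    using D A B C by (simp add: algebra_simps)
  then show ?thesis
    by (simp add: s_def d_def)
qed

end

section \<open>Recursions for the expected squared distance\<close>

text \<open>From \<open>1 + w / T \<le> exp (w / T)\<close>, raised to the power \<alpha>. Thus the
  initial-distance term moves from T to \<open>T + w\<close> without any loss.\<close>

lemma exp_decay_powr:
  fixes T w \<alpha> :: real
  assumes "T > 0" "w \<ge> 0" "\<alpha> \<ge> 0"
  shows "exp (- (\<alpha> * w / T)) / T powr \<alpha> \<le> 1 / (T + w) powr \<alpha>"
proof -
  have "(T + w) powr \<alpha> = (T * (1 + w / T)) powr \<alpha>"
    using assms by (simp add: distrib_left)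
  also have "\<dots> = T powr \<alpha> * (1 + w / T) powr \<alpha>"
    by (rule powr_mult)
  also have "\<dots> \<le> T powr \<alpha> * exp (w / T) powr \<alpha>"
    using assms by (intro mult_left_mono powr_mono2 exp_ge_add_one_self) auto
  also have "exp (w / T) powr \<alpha> = exp (\<alpha> * w / T)"
    by (simp add: powr_def)
  finally show ?thesis
    using assms by (simp add: exp_minus field_simps)
qed

text \<open>A fourth power decays strictly faster than the powers 2 and 3 of the error terms, and
  the difference, of first order in u, is the room for new errors.\<close>

lemma exp_decay_le:
  fixes u \<alpha> :: real
  assumes "u \<ge> 0" "\<alpha> \<ge> 4"
  shows "exp (- (\<alpha> * u)) \<le> 1 / (1 + u) ^ 4"
proof -
  have "(1 + u) ^ 4 \<le> exp u ^ 4"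
    using assms exp_ge_add_one_self[of u] by (intro power_mono) auto
  also have "\<dots> = exp (4 * u)"
    by (simp flip: exp_of_nat_mult)
  also have "\<dots> \<le> exp (\<alpha> * u)"
    using assms by (simp add: mult_right_mono)
  finally have "1 / exp (\<alpha> * u) \<le> 1 / (1 + u) ^ 4"
    using assms by (intro divide_left_mono) auto
  then show ?thesis
    by (simp add: exp_minus inverse_eq_divide)
qed

text \<open>The bounds are stated with the denominator of the next epoch: growing \<open>T\<close> to \<open>T + w\<close> costs at
  most \<open>exp (w / T)\<close> per power of \<open>T\<close>, whereas growing \<open>T - w\<close> to \<open>T\<close> could cost
  \<open>exp (2 * ln 2 * w / T)\<close>, which an exponent \<open>\<alpha>\<close> close to 4 cannot absorb.\<close>

lemma epoch_recursion_step:
  fixes T w \<alpha> P Q R A B a a' :: real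
  assumes T: "T > 0" and w: "0 \<le> w" "2 * w \<le> T" and \<alpha>: "\<alpha> \<ge> 4"
    and A: "0 \<le> A" "4 * A \<le> P" and B: "0 \<le> B" "8 * B \<le> Q" and R: "0 \<le> R"
    and a: "a \<le> P / T\<^sup>2 + Q * w\<^sup>2 / T ^ 3 + R / T powr \<alpha>"
    and a': "a' \<le> exp (- (\<alpha> * w / T)) * a + A * w / T ^ 3 + B * w ^ 3 / T ^ 4"
  shows "a' \<le> P / (T + w)\<^sup>2 + Q * w\<^sup>2 / (T + w) ^ 3 + R / (T + w) powr \<alpha>"
proof -
  \<comment> \<open>Since \<open>w \<le> T / 2\<close>, \<open>(1 + u) ^ 4\<close> is at most 6.
    Replacing the fourth power by the second or third therefore frees at least
    \<open>P * u / 3\<close> or \<open>Q * u / 6\<close>, which covers \<open>A * u\<close> or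
    \<open>B * u\<close>.\<close>
  define u where "u = w / T"
  define z where "z = exp (- (\<alpha> * w / T))"
  have u: "0 \<le> u" "u \<le> 1 / 2"
    using T w by (auto simp: u_def field_simps)
  have Tw: "T + w = T * (1 + u)" and wT: "w = u * T"
    using T by (simp_all add: u_def field_simps)
  have z: "z \<le> 1 / (1 + u) ^ 4" "0 \<le> z"
    using exp_decay_le[OF u(1) \<alpha>] by (simp_all add: z_def u_def)
  have "(1 + u) ^ 4 \<le> (3 / 2) ^ 4"
    using u by (intro power_mono) auto
  then have u4: "(1 + u) ^ 4 \<le> 6"
    by (simp add: power4_eq_xxxx)
  have pos: "0 < 1 + u"
    using u by simp
  have inv: "1 / 6 \<le> 1 / (1 + u) ^ 4"
    using u4 pos by (intro divide_left_mono) auto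
  have P: "z * P + A * u \<le> P / (1 + u)\<^sup>2"
  proof -
    have "P / (1 + u)\<^sup>2 - P / (1 + u) ^ 4 = (P * (2 * u + u\<^sup>2)) / (1 + u) ^ 4"
    proof -
      have "P / y\<^sup>2 - P / y ^ 4 = P * (y\<^sup>2 - 1) / y ^ 4" if "y > 0" for y
        using that by (simp add: field_simps power2_eq_square power4_eq_xxxx)
      from this[OF pos] show ?thesis
        by (simp add: power2_eq_square algebra_simps)
    qed
    moreover have "A * u \<le> (P * (2 * u + u\<^sup>2)) * (1 / (1 + u) ^ 4)"
    proof -
      have "6 * (A * u) \<le> 8 * A * u"
        using A u by simp
      also have "\<dots> \<le> (2 * P) * u"
        using A u by (intro mult_right_mono) auto
      also have "\<dots> \<le> P * (2 * u + u\<^sup>2)"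
        using A by (simp add: algebra_simps)
      finally have "A * u \<le> (P * (2 * u + u\<^sup>2)) * (1 / 6)"
        by simp
      also have "\<dots> \<le> (P * (2 * u + u\<^sup>2)) * (1 / (1 + u) ^ 4)"
        using A u by (intro mult_left_mono inv) auto
      finally show ?thesis .
    qed
    moreover have "z * P \<le> 1 / (1 + u) ^ 4 * P"
      using z A by (intro mult_right_mono) auto
    ultimately show ?thesis
      by simp
  qed
  have Q: "z * Q + B * u \<le> Q / (1 + u) ^ 3"
  proof -
    have "Q / (1 + u) ^ 3 - Q / (1 + u) ^ 4 = (Q * u) / (1 + u) ^ 4"
    proof -
      have "Q / y ^ 3 - Q / y ^ 4 = Q * (y - 1) / y ^ 4" if "y > 0" for y
        using that by (simp add: field_simps power3_eq_cube power4_eq_xxxx)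
      from this[OF pos] show ?thesis
        by simp
    qed
    moreover have "B * u \<le> (Q * u) * (1 / (1 + u) ^ 4)"
    proof -
      have "B * u \<le> Q / 6 * u"
        using B u by (intro mult_right_mono) auto
      also have "\<dots> = (Q * u) * (1 / 6)"
        by simp
      also have "\<dots> \<le> (Q * u) * (1 / (1 + u) ^ 4)"
        using B u by (intro mult_left_mono inv) auto
      finally show ?thesis .
    qed
    moreover have "z * Q \<le> 1 / (1 + u) ^ 4 * Q"
      using z B by (intro mult_right_mono) auto
    ultimately show ?thesis
      by simp
  qed
  have "z * a \<le> z * (P / T\<^sup>2 + Q * w\<^sup>2 / T ^ 3 + R / T powr \<alpha>)"
    using a z by (intro mult_left_mono) auto
  then have "a' \<le> z * (P / T\<^sup>2 + Q * w\<^sup>2 / T ^ 3 + R / T powr \<alpha>) + A * w / T ^ 3 + B * w ^ 3 / T ^ 4"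
    using a' unfolding z_def[symmetric] by linarith
  \<comment> \<open>Written with u, the error \<open>A * w / T ^ 3\<close> is \<open>A * u\<close>
    in units of \<open>1 / T ^ 2\<close>, and \<open>B * w ^ 3 / T ^ 4\<close> is
    \<open>B * u\<close> in units of \<open>w ^ 2 / T ^ 3\<close>.\<close>
  also have "\<dots> = (z * P + A * u) / T\<^sup>2 + (z * Q + B * u) * (w\<^sup>2 / T ^ 3) + R * (z / T powr \<alpha>)"
    using T by (simp add: u_def field_simps power2_eq_square power3_eq_cube power4_eq_xxxx)
  also have "\<dots> \<le> (P / (1 + u)\<^sup>2) / T\<^sup>2 + (Q / (1 + u) ^ 3) * (w\<^sup>2 / T ^ 3) + R * (1 / (T + w) powr \<alpha>)"
    using P Q R T w \<alpha> exp_decay_powr[OF T w(1), of \<alpha>] unfolding z_def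
    by (intro add_mono divide_right_mono mult_right_mono mult_left_mono) auto
  also have "\<dots> = P / (T + w)\<^sup>2 + Q * w\<^sup>2 / (T + w) ^ 3 + R / (T + w) powr \<alpha>"
    by (simp add: Tw power_mult_distrib mult_ac)
  finally show ?thesis .
qed

text \<open>The same recursion with increments of length 1: errors \<open>E / T ^ 2\<close>
  accumulate to \<open>E / T\<close> with no further constant, because a contraction exponent of at
  least 4 loses more than the one power that \<open>E / T\<close> needs.\<close>

lemma first_epoch_recursion:
  fixes b :: "nat \<Rightarrow> real" and \<alpha> k0 E :: real
  assumes \<alpha>: "\<alpha> \<ge> 4" "\<alpha> \<le> k0" and E: "0 \<le> E" and b0: "\<And>i. 0 \<le> b i"
    and step: "\<And>i. i < n \<Longrightarrow> b (Suc i) \<le> (1 - \<alpha> / (k0 + Suc i)) * b i + E / (k0 + Suc i)\<^sup>2"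
    and "i \<le> n"
  shows "b i \<le> ((k0 + 1) powr \<alpha> * b 0) / (k0 + i + 1) powr \<alpha> + E / (k0 + i + 1)"
  using \<open>i \<le> n\<close>
proof (induction i)
  case 0
  then show ?case
    using \<alpha> E by simp
next
  case (Suc i)
  define T where "T = k0 + i + 1"
  define R where "R = (k0 + 1) powr \<alpha> * b 0"
  define u where "u = 1 / T"
  have T: "4 \<le> T"
    using \<alpha> by (simp add: T_def)
  then have u: "0 < u" "u \<le> 1 / 4"
    by (auto simp: u_def field_simps)
  have R: "0 \<le> R"
    using b0 by (simp add: R_def)
  have IH: "b i \<le> R / T powr \<alpha> + E / T"
    using Suc by (simp add: R_def T_def)
  have "b (Suc i) \<le> (1 - \<alpha> / T) * b i + E / T\<^sup>2"
    using step[of i] Suc.prems by (simp add: T_def add_ac)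
  also have "(1 - \<alpha> / T) * b i \<le> exp (- (\<alpha> * 1 / T)) * b i"
    using b0[of i] exp_ge_add_one_self[of "- (\<alpha> / T)"] by (intro mult_right_mono) auto
  also have "exp (- (\<alpha> * 1 / T)) * b i \<le> exp (- (\<alpha> * 1 / T)) * (R / T powr \<alpha> + E / T)"
    using IH by (intro mult_left_mono) auto
  also have "\<dots> = R * (exp (- (\<alpha> * 1 / T)) / T powr \<alpha>) + E / T * exp (- (\<alpha> * u))"
    by (simp add: algebra_simps u_def)
  also have "R * (exp (- (\<alpha> * 1 / T)) / T powr \<alpha>) \<le> R * (1 / (T + 1) powr \<alpha>)"
    using R T \<alpha> by (intro mult_left_mono exp_decay_powr) auto
  finally have "b (Suc i) \<le> R / (T + 1) powr \<alpha> + (E / T * exp (- (\<alpha> * u)) + E / T\<^sup>2)"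
    by simp
  also have "E / T * exp (- (\<alpha> * u)) + E / T\<^sup>2 = E / T * (exp (- (\<alpha> * u)) + u)"
    by (simp add: u_def power2_eq_square algebra_simps)
  also have "\<dots> \<le> E / T * (1 / (1 + u))"
  proof (rule mult_left_mono)
    have "exp (- (\<alpha> * u)) \<le> 1 / (1 + u) ^ 4"
      using u \<alpha> by (intro exp_decay_le) auto
    \<comment> \<open>After multiplication by \<open>(1 + u) ^ 4\<close> the claim is
      \<open>1 + u * (1 + u) ^ 4 \<le> (1 + u) ^ 3\<close>. The right side is at least
      \<open>1 + 3 * u\<close>, and \<open>u \<le> 1 / 4\<close> keeps \<open>(1 + u) ^ 4\<close>
      below 3.\<close>
    moreover have "1 / (1 + u) ^ 4 + u \<le> 1 / (1 + u)"
    proof -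
      have "(1 + u) ^ 3 \<le> (5 / 4) ^ 3"
        using u by (intro power_mono) auto
      then have "(1 + u) ^ 3 \<le> 2"
        by (simp add: power3_eq_cube)
      then have "(1 + u) * (1 + u) ^ 3 \<le> (5 / 4) * 2"
        using u by (intro mult_mono) auto
      then have "u * (1 + u) ^ 4 \<le> u * 3"
        using u by (intro mult_left_mono) (auto simp: power_Suc[symmetric] simp del: power_Suc)
      also have "\<dots> \<le> (1 + u) ^ 3 - 1"
        using u by (simp add: power3_eq_cube algebra_simps)
      finally have "(1 + u * (1 + u) ^ 4) / (1 + u) ^ 4 \<le> (1 + u) ^ 3 / (1 + u) ^ 4"
        using u by (intro divide_right_mono) auto
      also have "\<dots> = 1 / (1 + u)"
        using u by (simp add: power4_eq_xxxx power3_eq_cube)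
      also have "(1 + u * (1 + u) ^ 4) / (1 + u) ^ 4 = 1 / (1 + u) ^ 4 + u"
        using u by (simp add: add_divide_distrib)
      finally show ?thesis .
    qed
    ultimately show "exp (- (\<alpha> * u)) + u \<le> 1 / (1 + u)"
      by linarith
  qed (use E T in auto)
  also have "E / T * (1 / (1 + u)) = E / (T + 1)"
    using T by (simp add: u_def field_simps)
  finally show ?case
    by (simp add: R_def T_def add_ac)
qed

section \<open>Bounds for a whole epoch\<close>

context shuffled_epoch
begin

lemma D_nonneg: "0 \<le> D i"
  unfolding D_def by (rule perm_avg_nonneg) simp

lemma D_0: "D 0 = (norm (x - xs))\<^sup>2"
  by (simp add: D_def)

lemma large_step_epoch_bound:
  assumes const: "\<And>l. l \<in> {1..n} \<Longrightarrow> \<eta> l = t" and t_pos: "t > 0" and "i \<le> n"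
  shows "D i \<le> exp (- (t * \<mu> * i / 2)) * (norm (x - xs))\<^sup>2 + 5 * i * t\<^sup>2 * G\<^sup>2"
  using \<open>i \<le> n\<close>
proof (induction i)
  case (Suc i)
  define E where "E = exp (- (t * \<mu> / 2))"
  define d where "d = (norm (x - xs))\<^sup>2"
  have i: "i < n"
    using Suc.prems by simp
  have \<eta>: "\<eta> (Suc i) = t" "(\<Sum>j\<in>{Suc 0..i}. \<eta> j) = i * t"
    using Suc.prems const by simp_all
  have E: "0 \<le> E" "E \<le> 1"
    using t_pos mu_pos by (simp_all add: E_def)
  have "D (Suc i) \<le> (1 - t * \<mu> / 2) * D i + t\<^sup>2 * G\<^sup>2 + 2 * t * (2 * G\<^sup>2 / n * (i * t))"
    \<comment> \<open>For \<open>m = 0\<close> the variance term vanishes, so any bound on the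
      gradients at the minimizer will do. The constant 5 is 1 from the squared step and 4 from
      stability.\<close>
    using expected_step[of i 0 "Max ((\<lambda>j. norm (g j xs)) ` {1..n})"] i n_pos mu_pos
    by (simp add: \<eta>)
  also have "2 * t * (2 * G\<^sup>2 / n * (i * t)) = 4 * t\<^sup>2 * G\<^sup>2 * (i / n)"
    by (simp add: power2_eq_square)
  also have "\<dots> \<le> 4 * t\<^sup>2 * G\<^sup>2 * 1"
    using i by (intro mult_left_mono) auto
  also have "(1 - t * \<mu> / 2) * D i \<le> E * D i"
    unfolding E_def using D_nonneg exp_ge_add_one_self[of "- (t * \<mu> / 2)"] by (intro mult_right_mono) auto
  also have "E * D i \<le> E * (E ^ i * d + 5 * i * t\<^sup>2 * G\<^sup>2)"
    using Suc E by (intro mult_left_mono) (auto simp: E_def d_def mult_ac simp flip: exp_of_nat_mult)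
  also have "\<dots> = E ^ Suc i * d + E * (5 * i * t\<^sup>2 * G\<^sup>2)"
    by (simp add: algebra_simps)
  also have "E * (5 * i * t\<^sup>2 * G\<^sup>2) \<le> 1 * (5 * i * t\<^sup>2 * G\<^sup>2)"
    using E by (intro mult_right_mono) auto
  finally have "D (Suc i) \<le> E ^ Suc i * d + 5 * Suc i * t\<^sup>2 * G\<^sup>2"
    by (simp add: algebra_simps)
  also have "E ^ Suc i = exp (- (t * \<mu> * Suc i / 2))"
    unfolding E_def exp_of_nat_mult[symmetric] by (simp add: algebra_simps)
  finally show ?case
    by (simp add: d_def)
qed (simp add: D_0)

lemma epoch_bound:
  assumes H: "linear H" "\<And>y. y \<in> V \<Longrightarrow> (\<Sum>i\<in>{1..n}. g i y) = real n *\<^sub>R H (y - xs)"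
    and const: "\<And>l. l \<in> {1..n} \<Longrightarrow> \<eta> l = t" and t_pos: "t > 0"
  shows "D n \<le> exp (- (t * \<mu> * n / 2)) * (norm (x - xs))\<^sup>2
    + 20 * L\<^sup>2 * G\<^sup>2 / \<mu> * t ^ 3 * n + 80 * L ^ 4 * G\<^sup>2 / \<mu>\<^sup>2 * t ^ 4 * n ^ 3"
proof (cases "4 * (t * n * L) * L \<le> \<mu>")
  case True
  interpret constant_step_epoch V f g n L \<mu> xs \<eta> x G H t
    by (intro constant_step_epoch.intro shuffled_epoch_axioms constant_step_epoch_axioms.intro)
      (use True assms in auto)
  have "L\<^sup>2 * 1 \<le> L\<^sup>2 * (L / \<mu>)\<^sup>2"
    using mu_pos mu_le L_pos by (intro mult_left_mono) auto
  then have L4: "L\<^sup>2 \<le> L ^ 4 / \<mu>\<^sup>2"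
    by (simp add: power_divide power2_eq_square power4_eq_xxxx)
  have "32 * L\<^sup>2 * G\<^sup>2 * t ^ 4 * n ^ 3 = 32 * L\<^sup>2 * (G\<^sup>2 * t ^ 4 * n ^ 3)"
    by (simp add: mult_ac)
  also have "\<dots> \<le> (80 * (L ^ 4 / \<mu>\<^sup>2)) * (G\<^sup>2 * t ^ 4 * n ^ 3)"
    using L4 t_pos by (intro mult_right_mono mult_mono) auto
  finally have "32 * L\<^sup>2 * G\<^sup>2 * t ^ 4 * n ^ 3 \<le> 80 * L ^ 4 * G\<^sup>2 / \<mu>\<^sup>2 * t ^ 4 * n ^ 3"
    by simp
  then show ?thesis
    using constant_step_epoch_bound by simp
next
  case False
  \<comment> \<open>v measures how badly \<open>small\<close> fails. Multiplying by
    \<open>v ^ 2 \<ge> 1\<close> raises \<open>t ^ 2 * n\<close> to \<open>t ^ 4 * n ^ 3\<close>,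
    and \<open>80 = 5 * 4 ^ 2\<close>.\<close>
  define v where "v = 4 * (t * n * L) * L / \<mu>"
  have "1 \<le> v"
    using False mu_pos by (simp add: v_def field_simps)
  then have "5 * n * t\<^sup>2 * G\<^sup>2 * 1 \<le> 5 * n * t\<^sup>2 * G\<^sup>2 * v\<^sup>2"
    by (intro mult_left_mono) auto
  also have "\<dots> = 80 * L ^ 4 * G\<^sup>2 / \<mu>\<^sup>2 * t ^ 4 * n ^ 3"
    by (simp add: v_def power_divide power2_eq_square power3_eq_cube power4_eq_xxxx)
  finally have "5 * n * t\<^sup>2 * G\<^sup>2 \<le> 80 * L ^ 4 * G\<^sup>2 / \<mu>\<^sup>2 * t ^ 4 * n ^ 3"
    by simp
  moreover have "0 \<le> 20 * L\<^sup>2 * G\<^sup>2 / \<mu> * t ^ 3 * n"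
    using mu_pos t_pos by simp
  ultimately show ?thesis
    using large_step_epoch_bound[OF const t_pos order_refl] by linarith
qed

text \<open>In the first \<open>n / (4 * \<kappa>)\<close> steps the conditional bias of the sampled gradient is controlled
  by the variance of a partial sum of gradients at the minimizer; only the later steps use
  stability, where \<open>\<eta>\<close> is already of order \<open>\<kappa> / (\<mu> * n)\<close>. Stability alone would lose a factor
  \<open>ln n\<close>.\<close>

lemma first_epoch_bound:
  assumes \<alpha>: "\<alpha> \<ge> 4" and \<kappa>: "\<kappa> = L / \<mu>" and k0: "k0 = \<alpha> * \<kappa>"
    and \<eta>: "\<And>l. l \<in> {1..n} \<Longrightarrow> \<eta> l = (2 * \<alpha> / \<mu>) / (k0 + l)"
  shows "D n \<le> ((k0 + 1) powr \<alpha> * (norm (x - xs))\<^sup>2) / (k0 + n + 1) powr \<alpha>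
    + (4 * \<alpha>\<^sup>2 + 32 * \<alpha> * (1 + 2 * \<alpha>) * (1 + \<alpha>)) * G\<^sup>2 / L\<^sup>2 * \<kappa> ^ 4 / (k0 + n + 1)"
proof -
  define E where "E = (4 * \<alpha>\<^sup>2 + 32 * \<alpha> * (1 + 2 * \<alpha>) * (1 + \<alpha>)) * G\<^sup>2 / L\<^sup>2 * \<kappa> ^ 4"
  have \<kappa>1: "1 \<le> \<kappa>"
    using mu_pos mu_le by (simp add: \<kappa>)
  have k0_ge: "\<alpha> \<le> k0"
    using \<alpha> mult_left_mono[OF \<kappa>1, of \<alpha>] by (simp add: k0)
  have "1 / \<mu> = \<kappa> / L"
    using L_pos by (simp add: \<kappa>)
  then have mu2: "1 / \<mu>\<^sup>2 = \<kappa>\<^sup>2 / L\<^sup>2"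
    by (metis power_divide power_one)
  have Gs: "norm (g j xs) \<le> 2 * \<kappa> * G" if "j \<in> {1..n}" for j
  proof -
    have "norm (g j xs) \<le> (1 + L / \<mu>) * G"
      using grad_bound[OF permutes_id, of _ 0] n_pos by (intro grad_at_minimizer[OF start _ that]) simp
    also have "\<dots> \<le> (2 * \<kappa>) * G"
      using \<kappa>1 G_nonneg unfolding \<kappa> by (intro mult_right_mono) auto
    finally show ?thesis .
  qed
  have step: "D (Suc i) \<le> (1 - \<alpha> / (k0 + Suc i)) * D i + E / (k0 + Suc i)\<^sup>2" if i: "i < n" for i
  proof -
    define T where "T = k0 + Suc i"
    define t where "t = \<eta> (Suc i)"
    \<comment> \<open>The largest cut allowed by the condition
      \<open>4 * L * m \<le> n * \<mu>\<close> of \<open>expected_step\<close>; for earlier i the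
      cut is i itself and no position needs a swap.\<close>
    define i0 where "i0 = nat \<lfloor>n / (4 * \<kappa>)\<rfloor>"
    define m where "m = min i i0"
    have T: "0 < T"
      using k0_ge \<alpha> by (simp add: T_def)
    have t: "t = (2 * \<alpha> / \<mu>) / T"
      unfolding t_def T_def using i by (intro \<eta>) auto
    have t0: "0 \<le> t"
      using \<alpha> mu_pos T by (simp add: t)
    have i0: "real i0 \<le> n / (4 * \<kappa>)" "n / (4 * \<kappa>) < real i0 + 1"
      using \<kappa>1 by (simp_all add: i0_def)
    have m_le: "real m \<le> n / (4 * \<kappa>)"
      using i0 by (simp add: m_def)
    have mn: "real m < n"
      using i by (simp add: m_def)
    have "4 * L * m \<le> 4 * L * (n / (4 * \<kappa>))"
      using m_le L_pos by (intro mult_left_mono) auto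
    also have "\<dots> = n * \<mu>"
      using L_pos mu_pos by (simp add: \<kappa>)
    finally have mL: "4 * L * m \<le> n * \<mu>" .
    \<comment> \<open>The short prefix, a fraction of order \<open>1 / \<kappa>\<close> of the
      epoch, regains one of the two factors \<kappa> lost in bounding the squared gradients at the
      minimizer.\<close>
    have first: "8 * real m * (2 * \<kappa> * G)\<^sup>2 / (\<mu> * n\<^sup>2) \<le> 8 * \<kappa> * G\<^sup>2 / (\<mu> * n)"
    proof -
      have "8 * real m * (2 * \<kappa> * G)\<^sup>2 / (\<mu> * n\<^sup>2) \<le> 8 * (n / (4 * \<kappa>)) * (2 * \<kappa> * G)\<^sup>2 / (\<mu> * n\<^sup>2)"
        using m_le mu_pos by (intro divide_right_mono mult_right_mono mult_left_mono) auto
      also have "\<dots> = 8 * \<kappa> * G\<^sup>2 / (\<mu> * n)"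
        using \<kappa>1 n_pos by (simp add: power2_eq_square)
      finally show ?thesis .
    qed
    have second: "2 * G\<^sup>2 / (real n - real m) * (\<Sum>j\<in>{Suc m..i}. \<eta> j) \<le> 16 * \<alpha> * \<kappa> * G\<^sup>2 / (\<mu> * n)"
    proof -
      have "(\<Sum>j\<in>{Suc m..i}. \<eta> j) \<le> (\<Sum>j\<in>{Suc m..i}. 8 * \<alpha> * \<kappa> / (\<mu> * n))"
      proof (rule sum_mono)
        fix j assume j: "j \<in> {Suc m..i}"
        \<comment> \<open>A nonempty range above m excludes \<open>m = i\<close>, so every j in it
          exceeds \<open>n / (4 * \<kappa>)\<close>.\<close>
        then have "m = i0"
          by (auto simp: m_def)
        then have "n / (4 * \<kappa>) \<le> j"
          using i0 j by simp
        also have "\<dots> \<le> k0 + j"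
          using k0_ge \<alpha> by simp
        finally have "(2 * \<alpha> / \<mu>) / (k0 + j) \<le> (2 * \<alpha> / \<mu>) / (n / (4 * \<kappa>))"
          using \<alpha> mu_pos n_pos \<kappa>1 k0_ge by (intro divide_left_mono mult_pos_pos divide_pos_pos) auto
        then show "\<eta> j \<le> 8 * \<alpha> * \<kappa> / (\<mu> * n)"
          using \<eta>[of j] i j by (simp add: mult_ac)
      qed
      also have "\<dots> = (i - m) * (8 * \<alpha> * \<kappa> / (\<mu> * n))"
        by simp
      also have "\<dots> \<le> (real n - real m) * (8 * \<alpha> * \<kappa> / (\<mu> * n))"
        using i \<alpha> \<kappa>1 mu_pos by (intro mult_right_mono) (auto simp: m_def)
      finally have "2 * G\<^sup>2 / (real n - real m) * (\<Sum>j\<in>{Suc m..i}. \<eta> j)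
          \<le> 2 * G\<^sup>2 / (real n - real m) * ((real n - real m) * (8 * \<alpha> * \<kappa> / (\<mu> * n)))"
        using mn by (intro mult_left_mono) auto
      also have "\<dots> = 16 * \<alpha> * \<kappa> * G\<^sup>2 / (\<mu> * n)"
        using mn by simp
      finally show ?thesis .
    qed
    \<comment> \<open>The bias bound is of order \<open>1 / n\<close>; trading it for
      \<open>1 / T\<close> costs a factor of order \<kappa> and, together with the step size, gives
      an error of order \<open>1 / T ^ 2\<close>.\<close>
    have "T \<le> k0 + n"
      using i by (simp add: T_def)
    also have "k0 + n \<le> (1 + \<alpha>) * \<kappa> * n"
    proof -
      have "k0 * 1 \<le> k0 * n"
        using n_pos k0_ge \<alpha> by (intro mult_left_mono) auto
      moreover have "1 * real n \<le> \<kappa> * n"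
        using \<kappa>1 by (intro mult_right_mono) auto
      ultimately show ?thesis
        by (simp add: k0 algebra_simps)
    qed
    finally have "1 / n \<le> (1 + \<alpha>) * \<kappa> / T"
      using T n_pos by (simp add: field_simps)
    then have *: "8 * \<kappa> * G\<^sup>2 * (1 + 2 * \<alpha>) / \<mu> * (1 / n) \<le> 8 * \<kappa> * G\<^sup>2 * (1 + 2 * \<alpha>) / \<mu> * ((1 + \<alpha>) * \<kappa> / T)"
      using \<alpha> \<kappa>1 mu_pos by (intro mult_left_mono) auto
    have "8 * real m * (2 * \<kappa> * G)\<^sup>2 / (\<mu> * n\<^sup>2) + 2 * G\<^sup>2 / (real n - real m) * (\<Sum>j\<in>{Suc m..i}. \<eta> j)
        \<le> 8 * \<kappa> * G\<^sup>2 * (1 + 2 * \<alpha>) / \<mu> * ((1 + \<alpha>) * \<kappa> / T)"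
    proof -
      have "8 * \<kappa> * G\<^sup>2 / (\<mu> * n) + 16 * \<alpha> * \<kappa> * G\<^sup>2 / (\<mu> * n) = 8 * \<kappa> * G\<^sup>2 * (1 + 2 * \<alpha>) / \<mu> * (1 / n)"
        by (simp add: algebra_simps add_divide_distrib)
      then show ?thesis
        using first second * by linarith
    qed
    then have "2 * t * (8 * real m * (2 * \<kappa> * G)\<^sup>2 / (\<mu> * n\<^sup>2) + 2 * G\<^sup>2 / (real n - real m) * (\<Sum>j\<in>{Suc m..i}. \<eta> j))
        \<le> 2 * t * (8 * \<kappa> * G\<^sup>2 * (1 + 2 * \<alpha>) / \<mu> * ((1 + \<alpha>) * \<kappa> / T))"
      using t0 by (intro mult_left_mono) auto
    moreover have "D (Suc i) \<le> (1 - t * \<mu> / 2) * D i + t\<^sup>2 * G\<^sup>2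
        + 2 * t * (8 * real m * (2 * \<kappa> * G)\<^sup>2 / (\<mu> * n\<^sup>2) + 2 * G\<^sup>2 / (real n - real m) * (\<Sum>j\<in>{Suc m..i}. \<eta> j))"
      unfolding t_def by (rule expected_step[OF i _ mL Gs]) (auto simp: m_def)
    ultimately have "D (Suc i) \<le> (1 - t * \<mu> / 2) * D i
        + (t\<^sup>2 * G\<^sup>2 + 2 * t * (8 * \<kappa> * G\<^sup>2 * (1 + 2 * \<alpha>) / \<mu> * ((1 + \<alpha>) * \<kappa> / T)))"
      by linarith
    also have "t\<^sup>2 * G\<^sup>2 + 2 * t * (8 * \<kappa> * G\<^sup>2 * (1 + 2 * \<alpha>) / \<mu> * ((1 + \<alpha>) * \<kappa> / T))
        = (4 * \<alpha>\<^sup>2 * 1 + 32 * \<alpha> * (1 + 2 * \<alpha>) * (1 + \<alpha>) * \<kappa>\<^sup>2) * (G\<^sup>2 * (1 / \<mu>\<^sup>2) / T\<^sup>2)"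
      using T mu_pos by (simp add: t field_simps power2_eq_square)
    also have "\<dots> \<le> (4 * \<alpha>\<^sup>2 * \<kappa>\<^sup>2 + 32 * \<alpha> * (1 + 2 * \<alpha>) * (1 + \<alpha>) * \<kappa>\<^sup>2) * (G\<^sup>2 * (1 / \<mu>\<^sup>2) / T\<^sup>2)"
      using \<kappa>1 by (intro mult_right_mono add_right_mono mult_left_mono) auto
    also have "\<dots> = E / T\<^sup>2"
      unfolding mu2 by (simp add: E_def algebra_simps add_divide_distrib power2_eq_square power4_eq_xxxx)
    also have "t * \<mu> / 2 = \<alpha> / T"
      using mu_pos by (simp add: t)
    finally show ?thesis
      by (simp add: T_def)
  qed
  have "D n \<le> ((k0 + 1) powr \<alpha> * D 0) / (k0 + n + 1) powr \<alpha> + E / (k0 + n + 1)"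
    using \<alpha> L_pos \<kappa>1 by (intro first_epoch_recursion[OF \<alpha> k0_ge _ D_nonneg step order_refl]) (auto simp: E_def)
  then show ?thesis
    by (simp add: D_0 E_def)
qed

end

section \<open>RandomShuffle in d-space\<close>

lemma shuffle_iter_Suc_eq_gd_run:
  "shuffle_iter d n f \<eta> \<sigma> x0 (Suc k) i
    = gd_run (\<lambda>j. grad d (f j)) (\<eta> (Suc k)) (\<sigma> (Suc k)) (shuffle_iter d n f \<eta> \<sigma> x0 k n) i"
  by (induction i) (simp_all add: Let_def)

lemma shuffle_iter_cong:
  "(\<And>l. l \<in> {1..k} \<Longrightarrow> \<sigma> l = \<tau> l) \<Longrightarrow> shuffle_iter d n f \<eta> \<sigma> x0 k i = shuffle_iter d n f \<eta> \<tau> x0 k i"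
proof (induction k arbitrary: i)
  case (Suc k)
  then have "shuffle_iter d n f \<eta> \<sigma> x0 k n = shuffle_iter d n f \<eta> \<tau> x0 k n"
    by simp
  then show ?case
    using Suc.prems[of "Suc k"] unfolding shuffle_iter_Suc_eq_gd_run by simp
qed simp

section \<open>The law of the permutations, one epoch at a time\<close>

lemma finite_permutes: "finite {p. p permutes {1..n::nat}}"
  by (rule finite_permutations) simp

lemma permutes_nonempty: "{p. p permutes {1..n::nat}} \<noteq> {}"
  using permutes_id by blast

lemma set_shuffle_pmf:
  "set_pmf (shuffle_pmf n k) = PiE_dflt {1..k} id (\<lambda>_. {p. p permutes {1..n}})"
  unfolding shuffle_pmf_def
  by (simp add: set_Pi_pmf comp_def set_pmf_of_set[OF permutes_nonempty finite_permutes] del: One_nat_def)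

lemma finite_set_shuffle_pmf: "finite (set_pmf (shuffle_pmf n k))"
  unfolding set_shuffle_pmf using finite_permutes by (intro finite_PiE_dflt) auto

text \<open>True for every epoch number, since the default value \<open>id\<close> outside
  \<open>{1..k}\<close> is itself a permutation.\<close>

lemma set_shuffle_pmf_permutes: "\<sigma> \<in> set_pmf (shuffle_pmf n k) \<Longrightarrow> \<sigma> l permutes {1..n}"
  unfolding set_shuffle_pmf PiE_dflt_def by (cases "l \<in> {1..k}") (auto intro: permutes_id)

lemma shuffle_expectation_Suc:
  fixes h :: "(nat \<Rightarrow> nat \<Rightarrow> nat) \<Rightarrow> real"
  shows "measure_pmf.expectation (shuffle_pmf n (Suc k)) h
    = measure_pmf.expectation (shuffle_pmf n k) (\<lambda>\<sigma>. perm_avg n (\<lambda>p. h (\<sigma>(Suc k := p))))"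
proof -
  define U where "U = pmf_of_set {p. p permutes {1..n}}"
  have U: "finite (set_pmf U)"
    unfolding U_def using finite_permutes permutes_nonempty by (simp del: One_nat_def)
  have "{1..Suc k} = insert (Suc k) {1..k}"
    by auto
  then have "shuffle_pmf n (Suc k) = U \<bind> (\<lambda>p. shuffle_pmf n k \<bind> (\<lambda>\<sigma>. return_pmf (\<sigma>(Suc k := p))))"
    unfolding shuffle_pmf_def U_def by (simp only: Pi_pmf_insert' finite_atLeastAtMost) (simp add: Pi_pmf_insert')
  also have "\<dots> = shuffle_pmf n k \<bind> (\<lambda>\<sigma>. U \<bind> (\<lambda>p. return_pmf (\<sigma>(Suc k := p))))"
    by (rule bind_commute_pmf)
  also have "\<dots> = shuffle_pmf n k \<bind> (\<lambda>\<sigma>. map_pmf (\<lambda>p. \<sigma>(Suc k := p)) U)"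
    by (simp add: map_pmf_def)
  finally have "measure_pmf.expectation (shuffle_pmf n (Suc k)) h
      = (\<Sum>\<sigma>\<in>set_pmf (shuffle_pmf n k). pmf (shuffle_pmf n k) \<sigma>
          *\<^sub>R measure_pmf.expectation (map_pmf (\<lambda>p. \<sigma>(Suc k := p)) U) h)"
    using finite_set_shuffle_pmf U by (simp only: pmf_expectation_bind finite_imageI set_map_pmf subset_refl)
  also have "\<dots> = measure_pmf.expectation (shuffle_pmf n k)
      (\<lambda>\<sigma>. measure_pmf.expectation (map_pmf (\<lambda>p. \<sigma>(Suc k := p)) U) h)"
    by (rule integral_measure_pmf[symmetric]) (auto intro: finite_set_shuffle_pmf)
  also have "(\<lambda>\<sigma>. measure_pmf.expectation (map_pmf (\<lambda>p. \<sigma>(Suc k := p)) U) h)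
      = (\<lambda>\<sigma>. perm_avg n (\<lambda>p. h (\<sigma>(Suc k := p))))"
    unfolding U_def perm_avg_def
    by (simp add: integral_pmf_of_set[OF permutes_nonempty finite_permutes] card_permutations
        divide_inverse mult.commute del: One_nat_def)
  finally show ?thesis .
qed

lemma shuffle_expectation_step:
  fixes h u :: "(nat \<Rightarrow> nat \<Rightarrow> nat) \<Rightarrow> real"
  assumes "\<And>\<sigma>. \<sigma> \<in> set_pmf (shuffle_pmf n k) \<Longrightarrow> perm_avg n (\<lambda>p. h (\<sigma>(Suc k := p))) \<le> c * u \<sigma> + b"
  shows "measure_pmf.expectation (shuffle_pmf n (Suc k)) h \<le> c * measure_pmf.expectation (shuffle_pmf n k) u + b"
proof -
  have int: "integrable (measure_pmf (shuffle_pmf n k)) v" for v :: "_ \<Rightarrow> real"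
    by (rule integrable_measure_pmf_finite[OF finite_set_shuffle_pmf])
  have "measure_pmf.expectation (shuffle_pmf n (Suc k)) h \<le> measure_pmf.expectation (shuffle_pmf n k) (\<lambda>\<sigma>. c * u \<sigma> + b)"
    unfolding shuffle_expectation_Suc using assms
    by (intro integral_mono_AE int) (simp add: AE_measure_pmf_iff)
  also have "\<dots> = c * measure_pmf.expectation (shuffle_pmf n k) u + b"
    by (simp add: int)
  finally show ?thesis .
qed

section \<open>Gradients on d-space and the hypotheses of the abstract analysis\<close>

lemma grad_convex_below:
  assumes conv: "convex_on (Rd d) h" and diff: "h differentiable_on Rd d" and x: "x \<in> Rd d" and y: "y \<in> Rd d"
  shows "h y \<ge> h x + inner (grad d h x) (y - x)"
proof -
  \<comment> \<open>Reduction to one variable. The line l stays in \<open>Rd d\<close>, so a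
    derivative taken within \<open>Rd d\<close> is enough for the chain rule.\<close>
  define l where "l s = x + s *\<^sub>R (y - x)" for s :: real
  have l: "l s \<in> Rd d" for s
    unfolding l_def using x y
    by (intro subspace_add[OF subspace_Rd] subspace_scale[OF subspace_Rd] subspace_diff[OF subspace_Rd])
  have affine: "l ((1 - u) *\<^sub>R s + u *\<^sub>R s') = (1 - u) *\<^sub>R l s + u *\<^sub>R l s'" for u s s'
    by (simp add: l_def algebra_simps)
  have "convex_on UNIV (h \<circ> l)"
  proof (rule convex_onI)
    fix u s s' :: real
    assume "0 < u" "u < 1"
    then show "(h \<circ> l) ((1 - u) *\<^sub>R s + u *\<^sub>R s') \<le> (1 - u) * (h \<circ> l) s + u * (h \<circ> l) s'"
      unfolding o_def affine by (intro convex_onD[OF conv] l) auto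
  qed simp
  moreover have "(h \<circ> l has_field_derivative inner (grad d h x) (y - x)) (at 0)"
  proof -
    have "(h has_derivative (\<lambda>v. inner (grad d h x) v)) (at (l 0) within Rd d)"
      using grad_works(2)[OF x] diff x by (simp add: differentiable_on_def l_def)
    then have "(h has_derivative (\<lambda>v. inner (grad d h x) v)) (at (l 0) within l ` UNIV)"
      by (rule has_derivative_subset) (use l in auto)
    moreover have "(l has_derivative (\<lambda>s. s *\<^sub>R (y - x))) (at 0)"
      unfolding l_def by (auto intro!: derivative_eq_intros)
    ultimately have "(h \<circ> l has_derivative (\<lambda>v. inner (grad d h x) v) \<circ> (\<lambda>s. s *\<^sub>R (y - x))) (at 0)"
      by (rule diff_chain_within[rotated])
    then show ?thesis
      by (simp add: has_field_derivative_def o_def mult_commute_abs)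
  qed
  ultimately have "(h \<circ> l) 1 - (h \<circ> l) 0 \<ge> inner (grad d h x) (y - x) * (1 - 0)"
    by (intro convex_on_imp_above_tangent[where A = UNIV and f = "h \<circ> l"]) simp_all
  then show ?thesis
    by (simp add: l_def)
qed

lemma grad_average:
  assumes diff: "\<And>i. i \<in> {1..n} \<Longrightarrow> f i differentiable_on Rd d" and x: "x \<in> Rd d" and "n > 0"
  shows "real n *\<^sub>R grad d (\<lambda>x. (\<Sum>i\<in>{1..n}. f i x) / real n) x = (\<Sum>i\<in>{1..n}. grad d (f i) x)"
proof -
  have f: "grad d (f i) x \<in> Rd d" "(f i has_derivative (\<lambda>v. inner (grad d (f i) x) v)) (at x within Rd d)"
    if "i \<in> {1..n}" for i
    using grad_works[OF x, of "f i"] diff[OF that] x by (auto simp: differentiable_on_def)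
  have "grad d (\<lambda>x. (\<Sum>i\<in>{1..n}. f i x) / real n) x = (1 / real n) *\<^sub>R (\<Sum>i\<in>{1..n}. grad d (f i) x)"
  proof (rule grad_eqI[OF x])
    show "(1 / real n) *\<^sub>R (\<Sum>i\<in>{1..n}. grad d (f i) x) \<in> Rd d"
      by (intro subspace_scale[OF subspace_Rd] subspace_sum[OF subspace_Rd] f)
    have "((\<lambda>x. (\<Sum>i\<in>{1..n}. f i x) / real n) has_derivative (\<lambda>v. (\<Sum>i\<in>{1..n}. inner (grad d (f i) x) v) / real n))
        (at x within Rd d)"
      by (intro bounded_linear.has_derivative[OF bounded_linear_divide] has_derivative_sum f)
    also have "(\<lambda>v. (\<Sum>i\<in>{1..n}. inner (grad d (f i) x) v) / real n)
        = inner ((1 / real n) *\<^sub>R (\<Sum>i\<in>{1..n}. grad d (f i) x))"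
      by (simp add: fun_eq_iff inner_sum_left)
    finally show "((\<lambda>x. (\<Sum>i\<in>{1..n}. f i x) / real n) has_derivative
        inner ((1 / real n) *\<^sub>R (\<Sum>i\<in>{1..n}. grad d (f i) x))) (at x within Rd d)" .
  qed
  then show ?thesis
    using \<open>n > 0\<close> by simp
qed

lemma lookup_eq_inner_single: "Poly_Mapping.lookup x i = inner (Poly_Mapping.single i 1) x"
  for x :: "nat \<Rightarrow>\<^sub>0 real"
  by (simp add: inner_poly_mapping_def)

lemma grad_quadratic:
  assumes "quadratic_on_Rd d h"
  obtains H b where "linear H" "\<And>x. x \<in> Rd d \<Longrightarrow> grad d h x = H x + b"
proof -
  from assms obtain A :: "nat \<Rightarrow> nat \<Rightarrow> real" and b :: "nat \<Rightarrow> real" and c :: real where h: "\<And>x. x \<in> Rd d \<Longrightarrow>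
      h x = (\<Sum>i<d. \<Sum>j<d. A i j * Poly_Mapping.lookup x i * Poly_Mapping.lookup x j)
        + (\<Sum>i<d. b i * Poly_Mapping.lookup x i) + c"
    unfolding quadratic_on_Rd_def by blast
  define e :: "nat \<Rightarrow> nat \<Rightarrow>\<^sub>0 real" where "e i = Poly_Mapping.single i 1" for i
  \<comment> \<open>The coefficients need not be symmetric, so this is the matrix plus its transpose
    applied to x.\<close>
  define H where "H x = (\<Sum>i<d. \<Sum>j<d. (A i j * inner (e j) x) *\<^sub>R e i + (A i j * inner (e i) x) *\<^sub>R e j)" for x
  define b' where "b' = (\<Sum>i<d. b i *\<^sub>R e i)"
  have e: "e i \<in> Rd d" if "i < d" for i
    unfolding e_def using that by (rule single_in_Rd)
  have "linear H"
    by (rule linearI) (simp_all add: H_def inner_add_right scaleR_sum_right sum.distrib[symmetric] algebra_simps)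
  moreover have "grad d h x = H x + b'" if x: "x \<in> Rd d" for x
  proof (rule grad_eqI[OF x])
    show "H x + b' \<in> Rd d"
      unfolding H_def b'_def
      by (intro subspace_add[OF subspace_Rd] subspace_sum[OF subspace_Rd] subspace_scale[OF subspace_Rd] e) auto
    define q where "q x = (\<Sum>i<d. \<Sum>j<d. A i j * inner (e i) x * inner (e j) x) + (\<Sum>i<d. b i * inner (e i) x) + c" for x
    have "(q has_derivative (\<lambda>v. (\<Sum>i<d. \<Sum>j<d. A i j * inner (e i) x * inner (e j) v + A i j * inner (e i) v * inner (e j) x)
        + (\<Sum>i<d. b i * inner (e i) v))) (at x within Rd d)"
      unfolding q_def by (auto intro!: derivative_eq_intros)
    also have "(\<lambda>v. (\<Sum>i<d. \<Sum>j<d. A i j * inner (e i) x * inner (e j) v + A i j * inner (e i) v * inner (e j) x)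
        + (\<Sum>i<d. b i * inner (e i) v)) = (\<lambda>v. inner (H x + b') v)"
      by (simp add: H_def b'_def inner_add_left inner_sum_left mult_ac add.commute)
    \<comment> \<open>q agrees with h on \<open>Rd d\<close> only, but a derivative within
      \<open>Rd d\<close> sees no other points; the radius 1 is arbitrary.\<close>
    finally show "(h has_derivative (\<lambda>v. inner (H x + b') v)) (at x within Rd d)"
      by (rule has_derivative_transform_within[where d = 1])
        (use x in \<open>auto simp: h q_def e_def lookup_eq_inner_single\<close>)
  qed
  ultimately show ?thesis
    using that by blast
qed

lemma strongly_convex_sum_Rd:
  assumes L: "L > 0" and \<mu>: "\<mu> > 0" and d: "d \<ge> 1" and n: "n > 0"
    and F: "F = (\<lambda>x. (\<Sum>i\<in>{1..n}. f i x) / real n)"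
    and strong: "strongly_convex_on_Rd d \<mu> F"
    and f: "\<And>i. i \<in> {1..n} \<Longrightarrow> convex_on (Rd d) (f i) \<and> smooth_on_Rd d L (f i)"
    and min: "is_arg_min F (\<lambda>x. x \<in> Rd d) xs"
  shows "strongly_convex_sum (Rd d) f (\<lambda>i. grad d (f i)) n L \<mu> xs"
    and "\<And>x. x \<in> Rd d \<Longrightarrow> F x - F xs \<le> L / 2 * (norm (x - xs))\<^sup>2"
proof -
  have xs: "xs \<in> Rd d"
    using min by (simp add: is_arg_min_def)
  have diff: "f i differentiable_on Rd d" if "i \<in> {1..n}" for i
    using f[OF that] by (simp add: smooth_on_Rd_def)
  have gV: "grad d (f i) x \<in> Rd d" if "i \<in> {1..n}" "x \<in> Rd d" for i x
    using diff[OF that(1)] that(2) by (intro grad_works(1)) (auto simp: differentiable_on_def)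
  interpret smooth_convex_sum "Rd d" f "\<lambda>i. grad d (f i)" n L
  proof
    show "f i x + inner (grad d (f i) x) (y - x) \<le> f i y" if "i \<in> {1..n}" "x \<in> Rd d" "y \<in> Rd d" for i x y
      using f[OF that(1)] diff[OF that(1)] that(2,3) by (intro grad_convex_below) auto
    show "f i y \<le> f i x + inner (grad d (f i) x) (y - x) + L / 2 * (norm (y - x))\<^sup>2"
      if "i \<in> {1..n}" "x \<in> Rd d" "y \<in> Rd d" for i x y
      using f[OF that(1)] that(2,3) by (simp add: smooth_on_Rd_def)
  qed (use L n gV subspace_Rd in auto)
  have gF: "real n *\<^sub>R grad d F x = (\<Sum>i\<in>{1..n}. grad d (f i) x)" if "x \<in> Rd d" for x
    unfolding F using diff that n by (rule grad_average)
  have nF: "real n * F x = (\<Sum>i\<in>{1..n}. f i x)" for x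
    using n by (simp add: F)
  have upper: "F y \<le> F x + inner (grad d F x) (y - x) + L / 2 * (norm (y - x))\<^sup>2"
    if "x \<in> Rd d" "y \<in> Rd d" for x y
  proof -
    have "real n * F y \<le> (\<Sum>i\<in>{1..n}. f i x + inner (grad d (f i) x) (y - x) + L / 2 * (norm (y - x))\<^sup>2)"
      unfolding nF using that by (intro sum_mono smooth_above)
    also have "\<dots> = real n * F x + inner (real n *\<^sub>R grad d F x) (y - x) + real n * (L / 2 * (norm (y - x))\<^sup>2)"
      unfolding gF[OF that(1)] nF by (simp add: sum.distrib inner_sum_left)
    also have "\<dots> = real n * (F x + inner (grad d F x) (y - x) + L / 2 * (norm (y - x))\<^sup>2)"
      by (simp add: algebra_simps)
    finally show ?thesis
      using n by simp
  qed
  have F_min: "F xs \<le> F y" if "y \<in> Rd d" for y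
    using min that by (auto simp: is_arg_min_def not_less)
  have gF_V: "grad d F xs \<in> Rd d"
  proof -
    have "(1 / real n) *\<^sub>R (real n *\<^sub>R grad d F xs) \<in> Rd d"
      unfolding gF[OF xs] using gV xs by (intro subspace_scale[OF subspace_Rd] subspace_sum[OF subspace_Rd]) auto
    then show ?thesis
      using n by simp
  qed
  have grad0: "grad d F xs = 0"
  proof -
    define v where "v = grad d F xs"
    \<comment> \<open>A gradient step of length \<open>1 / L\<close> would lower F below its minimum
      unless the gradient vanishes.\<close>
    define y where "y = xs - (1 / L) *\<^sub>R v"
    have "y \<in> Rd d"
      unfolding y_def v_def using xs gF_V by (intro subspace_diff[OF subspace_Rd] subspace_scale[OF subspace_Rd])
    then have "0 \<le> inner v (y - xs) + L / 2 * (norm (y - xs))\<^sup>2"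
      using F_min[of y] upper[OF xs, of y] by (simp add: v_def)
    also have "\<dots> = - (inner v v / (2 * L))"
      using L by (simp add: y_def power_mult_distrib power2_norm_eq_inner power2_eq_square[of L] power_divide field_simps)
    finally have "inner v v \<le> 0"
      using L by (simp add: divide_le_0_iff)
    then show ?thesis
      unfolding v_def by (metis inner_eq_zero_iff inner_ge_zero order_antisym)
  qed
  show "F x - F xs \<le> L / 2 * (norm (x - xs))\<^sup>2" if "x \<in> Rd d" for x
    using upper[OF xs that] by (simp add: grad0)
  have strongF: "F y \<ge> F x + inner (grad d F x) (y - x) + \<mu> / 2 * (norm (y - x))\<^sup>2" if "x \<in> Rd d" "y \<in> Rd d" for x y
    using strong that by (simp add: strongly_convex_on_Rd_def)
  have "\<mu> \<le> L"
  proof -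
    \<comment> \<open>Since \<open>d \<ge> 1\<close> there is a second point, at which the upper and
      lower quadratic bounds around the minimizer can be compared.\<close>
    define y where "y = xs + Poly_Mapping.single 0 (1::real)"
    have y: "y \<in> Rd d"
      unfolding y_def using xs d by (intro subspace_add[OF subspace_Rd] single_in_Rd) auto
    have "0 < (norm (y - xs))\<^sup>2"
      by (simp add: y_def)
    moreover have "\<mu> / 2 * (norm (y - xs))\<^sup>2 \<le> L / 2 * (norm (y - xs))\<^sup>2"
      using upper[OF xs y] strongF[OF xs y] by simp
    ultimately show ?thesis
      by simp
  qed
  show "strongly_convex_sum (Rd d) f (\<lambda>i. grad d (f i)) n L \<mu> xs"
  proof
    show "(\<Sum>i\<in>{1..n}. grad d (f i) xs) = 0"
      using gF[OF xs] by (simp add: grad0)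
    show "(\<Sum>i\<in>{1..n}. f i y) \<ge> (\<Sum>i\<in>{1..n}. f i x) + inner (\<Sum>i\<in>{1..n}. grad d (f i) x) (y - x)
        + real n * \<mu> / 2 * (norm (y - x))\<^sup>2" if "x \<in> Rd d" "y \<in> Rd d" for x y
    proof -
      have "real n * (F x + inner (grad d F x) (y - x) + \<mu> / 2 * (norm (y - x))\<^sup>2) \<le> real n * F y"
        using strongF[OF that] by (intro mult_left_mono) auto
      then show ?thesis
        unfolding gF[OF that(1), symmetric] nF[symmetric] by (simp add: algebra_simps)
    qed
  qed (use \<mu> \<open>\<mu> \<le> L\<close> xs in auto)
qed


text \<open>The constants are read off the two kinds of epoch. Cubes and fourth powers of the step
  size give \<open>160 = 20 * 2 ^ 3\<close> and \<open>1280 = 80 * 2 ^ 4\<close>;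
  \<open>epoch_recursion_step\<close> asks for 4 and 8 times these, which are 640 and 10240. The
  summand with c in Q, and all of R, come from the first epoch.\<close>

lemma expected_distance_bound:
  fixes L \<alpha> \<mu> \<kappa> k0 G :: real
  assumes sc: "strongly_convex_sum (Rd d) f (\<lambda>i. grad d (f i)) n L \<mu> xs"
    and H: "linear H" "\<And>y. y \<in> Rd d \<Longrightarrow> (\<Sum>i\<in>{1..n}. grad d (f i) y) = real n *\<^sub>R H (y - xs)"
    and \<alpha>: "\<alpha> \<ge> 4" and \<kappa>: "\<kappa> = L / \<mu>" and k0: "k0 = \<alpha> * \<kappa>"
    and \<eta>: "\<eta> = step_size \<mu> \<alpha> k0 n"
    and x0: "x0 \<in> Rd d" and S: "S \<subseteq> Rd d"
    and iter: "\<And>\<sigma> k i. (\<And>k. \<sigma> k permutes {1..n}) \<Longrightarrow> k \<in> {1..K} \<Longrightarrow> i \<in> {1..n} \<Longrightarrow>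
      shuffle_iter d n f \<eta> \<sigma> x0 k i \<in> S"
    and bnd: "\<And>i x. i \<in> {1..n} \<Longrightarrow> x \<in> insert x0 S \<Longrightarrow> norm (grad d (f i) x) \<le> G"
    and c: "c = 4 * \<alpha>\<^sup>2 + 32 * \<alpha> * (1 + 2 * \<alpha>) * (1 + \<alpha>)"
    and P: "P = 640 * \<alpha> ^ 3 * G\<^sup>2 / L\<^sup>2 * \<kappa> ^ 4"
    and Q: "Q = (10240 * \<alpha> ^ 4 + 2 * c * (\<alpha> + 2)\<^sup>2) * G\<^sup>2 / L\<^sup>2 * \<kappa> ^ 6"
    and R: "R = (2 * (\<alpha> + 1)) powr \<alpha> * \<kappa> powr \<alpha> * (norm (x0 - xs))\<^sup>2"
    and k: "1 \<le> k" "k \<le> K"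
  shows "measure_pmf.expectation (shuffle_pmf n k) (\<lambda>\<sigma>. (norm (shuffle_iter d n f \<eta> \<sigma> x0 k n - xs))\<^sup>2)
    \<le> P / (k0 + real n * real k + n)\<^sup>2 + Q * n\<^sup>2 / (k0 + real n * real k + n) ^ 3 + R / (k0 + real n * real k + n) powr \<alpha>"
  using k
proof (induction k)
  case (Suc k)
  interpret strongly_convex_sum "Rd d" f "\<lambda>i. grad d (f i)" n L \<mu> xs
    by (rule sc)
  have \<kappa>1: "1 \<le> \<kappa>"
    using mu_pos mu_le by (simp add: \<kappa>)
  have k0_ge: "\<alpha> \<le> k0"
    using \<alpha> mult_left_mono[OF \<kappa>1, of \<alpha>] by (simp add: k0)
  have k0_pos: "0 < k0"
    using k0_ge \<alpha> by simp
  have c0: "0 \<le> c"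
    using \<alpha> by (simp add: c)
  \<comment> \<open>\<open>k0 = \<alpha> * \<kappa>\<close> puts the largest possible step exactly
    at \<open>2 / L\<close>, the limit of nonexpansiveness.\<close>
  have step_le: "(2 * \<alpha> / \<mu>) / T \<le> 2 / L" if "k0 \<le> T" for T
  proof -
    have "(2 * \<alpha> / \<mu>) / T \<le> (2 * \<alpha> / \<mu>) / k0"
      using that k0_pos \<alpha> mu_pos by (intro divide_left_mono) auto
    also have "\<dots> = 2 / L"
      using \<alpha> mu_pos L_pos by (simp add: k0 \<kappa>)
    finally show ?thesis .
  qed
  have epoch: "shuffled_epoch (Rd d) f (\<lambda>i. grad d (f i)) n L \<mu> xs (\<eta> (Suc k)) (shuffle_iter d n f \<eta> \<sigma> x0 k n) G"
    if \<sigma>: "\<And>l. \<sigma> l permutes {1..n}" for \<sigma>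
  proof
    \<comment> \<open>The first epoch starts at x0, which need not belong to S; any later one starts
      at the last iterate of its predecessor.\<close>
    have start: "shuffle_iter d n f \<eta> \<sigma> x0 k n \<in> insert x0 S"
    proof (cases "k = 0")
      case False
      then have "shuffle_iter d n f \<eta> \<sigma> x0 k n \<in> S"
        using Suc.prems n_pos by (intro iter \<sigma>) auto
      then show ?thesis
        by simp
    qed simp
    then show "shuffle_iter d n f \<eta> \<sigma> x0 k n \<in> Rd d"
      using x0 S by auto
    show "0 \<le> \<eta> (Suc k) l \<and> \<eta> (Suc k) l \<le> 2 / L" if "l \<in> {1..n}" for l
      unfolding \<eta> step_size_def using \<alpha> mu_pos k0_pos
        step_le[of "k0 + real l"] step_le[of "k0 + real n * real (Suc k)"] by simp
    show "norm (grad d (f l) (gd_run (\<lambda>i. grad d (f i)) (\<eta> (Suc k)) p (shuffle_iter d n f \<eta> \<sigma> x0 k n) i)) \<le> G"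
      if p: "p permutes {1..n}" and l: "l \<in> {1..n}" and i: "i < n" for p l i
    proof (cases "i = 0")
      case True
      then show ?thesis
        using bnd[OF l start] by simp
    next
      case False
      \<comment> \<open>Boundedness holds for every realization, hence also after the current
        permutation is overwritten by p; the start of the epoch is unaffected.\<close>
      have "shuffle_iter d n f \<eta> (\<sigma>(Suc k := p)) x0 (Suc k) i \<in> S"
        using False Suc.prems i p \<sigma> by (intro iter) auto
      moreover have "shuffle_iter d n f \<eta> (\<sigma>(Suc k := p)) x0 k n = shuffle_iter d n f \<eta> \<sigma> x0 k n"
        by (rule shuffle_iter_cong) auto
      ultimately show ?thesis
        using bnd[OF l] unfolding shuffle_iter_Suc_eq_gd_run by simp
    qed
  qed
  have D_eq: "perm_avg n (\<lambda>p. (norm (shuffle_iter d n f \<eta> (\<sigma>(Suc k := p)) x0 (Suc k) n - xs))\<^sup>2)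
      = shuffled_epoch.D (\<lambda>i. grad d (f i)) n xs (\<eta> (Suc k)) (shuffle_iter d n f \<eta> \<sigma> x0 k n) n"
    if \<sigma>: "\<And>l. \<sigma> l permutes {1..n}" for \<sigma>
  proof -
    have "shuffle_iter d n f \<eta> (\<sigma>(Suc k := p)) x0 k n = shuffle_iter d n f \<eta> \<sigma> x0 k n" for p
      by (rule shuffle_iter_cong) auto
    then show ?thesis
      unfolding shuffled_epoch.D_def[OF epoch[OF \<sigma>]] shuffle_iter_Suc_eq_gd_run by simp
  qed
  show ?case
  proof (cases "k = 0")
    case True
    define d0 where "d0 = (norm (x0 - xs))\<^sup>2"
    define U where "U = k0 + 2 * n"
    define E where "E = c * G\<^sup>2 / L\<^sup>2 * \<kappa> ^ 4"
    have E: "0 \<le> E"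
      using c0 by (simp add: E_def)
    have U: "0 < U" "U \<le> 2 * (k0 + n + 1)"
      using k0_pos by (simp_all add: U_def)
    have bound: "shuffled_epoch.D (\<lambda>i. grad d (f i)) n xs (\<eta> (Suc k)) (shuffle_iter d n f \<eta> \<sigma> x0 k n) n
        \<le> ((k0 + 1) powr \<alpha> * d0) / (k0 + n + 1) powr \<alpha> + E / (k0 + n + 1)"
      if \<sigma>: "\<And>l. \<sigma> l permutes {1..n}" for \<sigma>
      using shuffled_epoch.first_epoch_bound[OF epoch[OF \<sigma>] \<alpha> \<kappa> k0] True
      by (simp add: \<eta> step_size_def d0_def E_def c)
    \<comment> \<open>No earlier expectation enters here, so the step lemma is used with factor
      0.\<close>
    have "measure_pmf.expectation (shuffle_pmf n (Suc k)) (\<lambda>\<sigma>. (norm (shuffle_iter d n f \<eta> \<sigma> x0 (Suc k) n - xs))\<^sup>2)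
        \<le> 0 * measure_pmf.expectation (shuffle_pmf n k) (\<lambda>_. 0)
          + (((k0 + 1) powr \<alpha> * d0) / (k0 + n + 1) powr \<alpha> + E / (k0 + n + 1))"
    proof (rule shuffle_expectation_step)
      fix \<sigma> assume "\<sigma> \<in> set_pmf (shuffle_pmf n k)"
      then have \<sigma>: "\<sigma> l permutes {1..n}" for l
        by (rule set_shuffle_pmf_permutes)
      show "perm_avg n (\<lambda>p. (norm (shuffle_iter d n f \<eta> (\<sigma>(Suc k := p)) x0 (Suc k) n - xs))\<^sup>2)
          \<le> 0 * 0 + (((k0 + 1) powr \<alpha> * d0) / (k0 + n + 1) powr \<alpha> + E / (k0 + n + 1))"
        unfolding D_eq[OF \<sigma>] using bound[OF \<sigma>] by simp
    qed
    also have "\<dots> \<le> R / U powr \<alpha> + Q * n\<^sup>2 / U ^ 3"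
    proof -
      \<comment> \<open>U is the denominator of the second epoch. The bounds
        \<open>k0 + 1 \<le> (\<alpha> + 1) * \<kappa>\<close> and
        \<open>U \<le> 2 * (k0 + n + 1)\<close> produce the constant in R.\<close>
      have "((k0 + 1) * U) powr \<alpha> \<le> (2 * (\<alpha> + 1) * \<kappa> * (k0 + n + 1)) powr \<alpha>"
      proof (rule powr_mono2)
        have "(k0 + 1) * U \<le> ((\<alpha> + 1) * \<kappa>) * (2 * (k0 + n + 1))"
          using U k0_pos \<kappa>1 \<alpha> by (intro mult_mono) (auto simp: k0 algebra_simps)
        then show "(k0 + 1) * U \<le> 2 * (\<alpha> + 1) * \<kappa> * (k0 + n + 1)"
          by (simp only: mult_ac)
      qed (use \<alpha> k0_pos U in auto)
      then have "(k0 + 1) powr \<alpha> * U powr \<alpha> \<le> (2 * (\<alpha> + 1)) powr \<alpha> * \<kappa> powr \<alpha> * (k0 + n + 1) powr \<alpha>"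
        by (simp only: powr_mult)
      then have "(k0 + 1) powr \<alpha> / (k0 + n + 1) powr \<alpha> \<le> (2 * (\<alpha> + 1)) powr \<alpha> * \<kappa> powr \<alpha> / U powr \<alpha>"
        using U k0_pos by (simp add: divide_simps)
      then have "(k0 + 1) powr \<alpha> / (k0 + n + 1) powr \<alpha> * d0 \<le> (2 * (\<alpha> + 1)) powr \<alpha> * \<kappa> powr \<alpha> / U powr \<alpha> * d0"
        by (rule mult_right_mono) (simp add: d0_def)
      then have "((k0 + 1) powr \<alpha> * d0) / (k0 + n + 1) powr \<alpha> \<le> R / U powr \<alpha>"
        by (simp add: R d0_def)
      \<comment> \<open>\<open>1 / U\<close> is \<open>U ^ 2 / U ^ 3\<close>, and
        \<open>U \<le> (\<alpha> + 2) * \<kappa> * n\<close>. This raises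
        \<open>\<kappa> ^ 4\<close> to \<open>\<kappa> ^ 6\<close> and supplies the factor
        \<open>n ^ 2\<close>.\<close>
      moreover have "E / (k0 + n + 1) \<le> Q * n\<^sup>2 / U ^ 3"
      proof -
        have "k0 * 1 \<le> k0 * n"
          using n_pos k0_pos by (intro mult_left_mono) auto
        moreover have "1 * real n \<le> \<kappa> * n"
          using \<kappa>1 by (intro mult_right_mono) auto
        ultimately have "U \<le> (\<alpha> + 2) * \<kappa> * n"
          by (simp add: U_def k0 algebra_simps)
        then have U2: "U\<^sup>2 \<le> ((\<alpha> + 2) * \<kappa> * n)\<^sup>2"
          using U by (intro power_mono) auto
        have "E / (k0 + n + 1) \<le> E / (U / 2)"
          using E U by (intro divide_left_mono) auto
        also have "\<dots> = 2 * E * U\<^sup>2 / U ^ 3"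
          using U by (simp add: power2_eq_square power3_eq_cube)
        also have "\<dots> \<le> 2 * E * ((\<alpha> + 2) * \<kappa> * n)\<^sup>2 / U ^ 3"
          using E U U2 by (intro divide_right_mono mult_left_mono) auto
        also have "2 * E * ((\<alpha> + 2) * \<kappa> * n)\<^sup>2 = (2 * c * (\<alpha> + 2)\<^sup>2) * (G\<^sup>2 / L\<^sup>2 * \<kappa> ^ 6) * n\<^sup>2"
          by (simp add: E_def power_mult_distrib mult_ac flip: power_add)
        also have "\<dots> \<le> (10240 * \<alpha> ^ 4 + 2 * c * (\<alpha> + 2)\<^sup>2) * (G\<^sup>2 / L\<^sup>2 * \<kappa> ^ 6) * n\<^sup>2"
          using \<kappa>1 by (intro mult_right_mono) auto
        also have "\<dots> = Q * n\<^sup>2"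
          by (simp add: Q)
        finally show ?thesis
          using U by (simp add: divide_right_mono)
      qed
      ultimately show ?thesis
        by simp
    qed
    also have "\<dots> \<le> P / U\<^sup>2 + Q * n\<^sup>2 / U ^ 3 + R / U powr \<alpha>"
      using \<alpha> by (simp add: P)
    finally show ?thesis
      using True by (simp add: U_def algebra_simps)
  next
    case False
    define T where "T = k0 + real n * real (Suc k)"
    define t where "t = (2 * \<alpha> / \<mu>) / T"
    define A where "A = 160 * \<alpha> ^ 3 * G\<^sup>2 / L\<^sup>2 * \<kappa> ^ 4"
    define B where "B = 1280 * \<alpha> ^ 4 * G\<^sup>2 / L\<^sup>2 * \<kappa> ^ 6"
    have T: "0 < T" "k0 \<le> T"
      using k0_pos by (simp_all add: T_def add_pos_nonneg)
    have t: "0 < t"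
      using \<alpha> mu_pos T by (simp add: t_def)
    have bound: "shuffled_epoch.D (\<lambda>i. grad d (f i)) n xs (\<eta> (Suc k)) (shuffle_iter d n f \<eta> \<sigma> x0 k n) n
        \<le> exp (- (\<alpha> * n / T)) * (norm (shuffle_iter d n f \<eta> \<sigma> x0 k n - xs))\<^sup>2 + (A * n / T ^ 3 + B * real n ^ 3 / T ^ 4)"
      if \<sigma>: "\<And>l. \<sigma> l permutes {1..n}" for \<sigma>
    proof -
      have "\<eta> (Suc k) l = t" for l
        using False by (simp add: \<eta> step_size_def t_def T_def)
      then have "shuffled_epoch.D (\<lambda>i. grad d (f i)) n xs (\<eta> (Suc k)) (shuffle_iter d n f \<eta> \<sigma> x0 k n) n
        \<le> exp (- (t * \<mu> * n / 2)) * (norm (shuffle_iter d n f \<eta> \<sigma> x0 k n - xs))\<^sup>2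
          + 20 * L\<^sup>2 * G\<^sup>2 / \<mu> * t ^ 3 * n + 80 * L ^ 4 * G\<^sup>2 / \<mu>\<^sup>2 * t ^ 4 * real n ^ 3"
        using shuffled_epoch.epoch_bound[OF epoch[OF \<sigma>] H _ t] by simp
      moreover have "t * \<mu> * n / 2 = \<alpha> * n / T"
        using mu_pos by (simp add: t_def)
      moreover have "20 * L\<^sup>2 * G\<^sup>2 / \<mu> * t ^ 3 * n = A * n / T ^ 3"
        using mu_pos L_pos T
        by (simp add: t_def A_def \<kappa> power_divide power_mult_distrib field_simps) (simp add: power2_eq_square power3_eq_cube power4_eq_xxxx)
      moreover have "80 * L ^ 4 * G\<^sup>2 / \<mu>\<^sup>2 * t ^ 4 * real n ^ 3 = B * real n ^ 3 / T ^ 4"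
      proof -
        have "\<kappa> ^ 6 / L\<^sup>2 = L ^ 4 / \<mu> ^ 6"
          using L_pos by (simp add: \<kappa> power_divide divide_simps flip: power_add)
        moreover have "B * real n ^ 3 / T ^ 4 = 1280 * \<alpha> ^ 4 * G\<^sup>2 * (\<kappa> ^ 6 / L\<^sup>2) * real n ^ 3 / T ^ 4"
          by (simp add: B_def)
        moreover have "80 * L ^ 4 * G\<^sup>2 / \<mu>\<^sup>2 * t ^ 4 * real n ^ 3
            = 1280 * \<alpha> ^ 4 * G\<^sup>2 * (L ^ 4 / \<mu> ^ 6) * real n ^ 3 / T ^ 4"
          by (simp add: t_def power_divide power_mult_distrib flip: power_add)
        ultimately show ?thesis
          by simp
      qed
      ultimately show ?thesis
        by simp
    qed
    have T_eq: "T = k0 + n * k + n"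
      by (simp add: T_def algebra_simps)
    have "measure_pmf.expectation (shuffle_pmf n (Suc k)) (\<lambda>\<sigma>. (norm (shuffle_iter d n f \<eta> \<sigma> x0 (Suc k) n - xs))\<^sup>2)
        \<le> P / (T + n)\<^sup>2 + Q * (real n)\<^sup>2 / (T + n) ^ 3 + R / (T + n) powr \<alpha>"
    proof (rule epoch_recursion_step)
      show "measure_pmf.expectation (shuffle_pmf n k) (\<lambda>\<sigma>. (norm (shuffle_iter d n f \<eta> \<sigma> x0 k n - xs))\<^sup>2)
          \<le> P / T\<^sup>2 + Q * (real n)\<^sup>2 / T ^ 3 + R / T powr \<alpha>"
        using Suc.IH Suc.prems False by (simp add: T_eq)
      have "measure_pmf.expectation (shuffle_pmf n (Suc k)) (\<lambda>\<sigma>. (norm (shuffle_iter d n f \<eta> \<sigma> x0 (Suc k) n - xs))\<^sup>2)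
          \<le> exp (- (\<alpha> * n / T)) * measure_pmf.expectation (shuffle_pmf n k) (\<lambda>\<sigma>. (norm (shuffle_iter d n f \<eta> \<sigma> x0 k n - xs))\<^sup>2)
            + (A * n / T ^ 3 + B * real n ^ 3 / T ^ 4)"
      proof (rule shuffle_expectation_step)
        fix \<sigma> assume "\<sigma> \<in> set_pmf (shuffle_pmf n k)"
        then have \<sigma>: "\<sigma> l permutes {1..n}" for l
          by (rule set_shuffle_pmf_permutes)
        show "perm_avg n (\<lambda>p. (norm (shuffle_iter d n f \<eta> (\<sigma>(Suc k := p)) x0 (Suc k) n - xs))\<^sup>2)
            \<le> exp (- (\<alpha> * n / T)) * (norm (shuffle_iter d n f \<eta> \<sigma> x0 k n - xs))\<^sup>2
              + (A * n / T ^ 3 + B * real n ^ 3 / T ^ 4)"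
          unfolding D_eq[OF \<sigma>] by (rule bound[OF \<sigma>])
      qed
      then show "measure_pmf.expectation (shuffle_pmf n (Suc k)) (\<lambda>\<sigma>. (norm (shuffle_iter d n f \<eta> \<sigma> x0 (Suc k) n - xs))\<^sup>2)
          \<le> exp (- (\<alpha> * n / T)) * measure_pmf.expectation (shuffle_pmf n k) (\<lambda>\<sigma>. (norm (shuffle_iter d n f \<eta> \<sigma> x0 k n - xs))\<^sup>2)
            + A * n / T ^ 3 + B * real n ^ 3 / T ^ 4"
        by simp
      \<comment> \<open>Epoch \<open>Suc k\<close> is at least the second.\<close>
      show "2 * real n \<le> T"
      proof -
        have "real n * 2 \<le> real n * Suc k"
          using False by (intro mult_left_mono) auto
        then show ?thesis
          using k0_pos by (simp add: T_def)
      qed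
      show "8 * B \<le> Q"
      proof -
        have "8 * B = 10240 * \<alpha> ^ 4 * (G\<^sup>2 / L\<^sup>2 * \<kappa> ^ 6)"
          by (simp add: B_def)
        also have "\<dots> \<le> (10240 * \<alpha> ^ 4 + 2 * c * (\<alpha> + 2)\<^sup>2) * (G\<^sup>2 / L\<^sup>2 * \<kappa> ^ 6)"
          using \<kappa>1 c0 by (intro mult_right_mono) auto
        finally show ?thesis
          by (simp add: Q)
      qed
      show "4 * A \<le> P"
        by (simp add: A_def P)
    qed (use \<alpha> T \<kappa>1 in \<open>auto simp: A_def B_def R\<close>)
    then show ?thesis
      by (simp only: T_def of_nat_power)
  qed
qed simp

theorem theorem4:
  fixes L G \<alpha> :: real
  assumes "L > 0" and "\<alpha> > 4"
  shows "\<exists>C::real. \<forall>(d::nat) (n::nat) (\<mu>::real) (\<kappa>::real) (k0::real)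
      (f :: nat \<Rightarrow> (nat \<Rightarrow>\<^sub>0 real) \<Rightarrow> real) (F :: (nat \<Rightarrow>\<^sub>0 real) \<Rightarrow> real)
      (xs :: nat \<Rightarrow>\<^sub>0 real) (x0 :: nat \<Rightarrow>\<^sub>0 real) (S :: (nat \<Rightarrow>\<^sub>0 real) set)
      (\<eta> :: nat \<Rightarrow> nat \<Rightarrow> real) (grads :: real set) (K::nat).
    d \<ge> 1 \<longrightarrow> n \<ge> 2 \<longrightarrow> \<mu> > 0 \<longrightarrow> \<kappa> = L / \<mu> \<longrightarrow> k0 = \<alpha> * \<kappa> \<longrightarrow>
    F = (\<lambda>x. (\<Sum>i\<in>{1..n}. f i x) / real n) \<longrightarrow>
    quadratic_on_Rd d F \<longrightarrow> strongly_convex_on_Rd d \<mu> F \<longrightarrow>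
    (\<forall>i\<in>{1..n}. convex_on (Rd d) (f i) \<and> smooth_on_Rd d L (f i)) \<longrightarrow>
    is_arg_min F (\<lambda>x. x \<in> Rd d) xs \<longrightarrow>
    x0 \<in> Rd d \<longrightarrow>
    \<eta> = step_size \<mu> \<alpha> k0 n \<longrightarrow>
    K \<ge> 1 \<longrightarrow>
    S \<subseteq> Rd d \<longrightarrow> compact S \<longrightarrow>
    (\<forall>\<sigma>. (\<forall>k\<in>{1..K}. \<sigma> k permutes {1..n}) \<longrightarrow>
       (\<forall>k\<in>{1..K}. \<forall>i\<in>{1..n}. shuffle_iter d n f \<eta> \<sigma> x0 k i \<in> S)) \<longrightarrow>
    grads = {norm (grad d (f i) x) | i x. i \<in> {1..n} \<and> x \<in> convex hull (insert x0 S)} \<longrightarrow>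
    G \<in> grads \<longrightarrow> (\<forall>g\<in>grads. g \<le> G) \<longrightarrow>
    (\<exists>c1 c2 c3 :: real. c1 \<le> C * \<kappa> ^ 4 \<and> c2 \<le> C * \<kappa> ^ 6 \<and> c3 \<le> C * \<kappa> powr \<alpha> \<and>
       measure_pmf.expectation (shuffle_pmf n K)
         (\<lambda>\<sigma>. F (shuffle_iter d n f \<eta> \<sigma> x0 (Suc K) 0)) - F xs
       \<le> c1 / (k0 + real n * real K)\<^sup>2
         + c2 * (real n)\<^sup>2 / (k0 + real n * real K) ^ 3
         + c3 * (norm (x0 - xs))\<^sup>2 / (k0 + real n * real K) powr \<alpha>)"
proof -
  define c where "c = 4 * \<alpha>\<^sup>2 + 32 * \<alpha> * (1 + 2 * \<alpha>) * (1 + \<alpha>)"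
  define C1 where "C1 = L / 2 * (640 * \<alpha> ^ 3 * G\<^sup>2 / L\<^sup>2)"
  define C2 where "C2 = L / 2 * ((10240 * \<alpha> ^ 4 + 2 * c * (\<alpha> + 2)\<^sup>2) * G\<^sup>2 / L\<^sup>2)"
  define C3 where "C3 = L / 2 * (2 * (\<alpha> + 1)) powr \<alpha>"
  have C: "0 \<le> C1" "0 \<le> C2" "0 \<le> C3"
    using assms by (simp_all add: C1_def C2_def C3_def c_def)
  show ?thesis
  proof (rule exI[of _ "C1 + C2 + C3"], intro allI impI, goal_cases)
    case (1 d n \<mu> \<kappa> k0 f F xs x0 S \<eta> grads K)
    have \<alpha>: "\<alpha> \<ge> 4" and n: "n > 0"
      using assms 1 by simp_all
    have \<kappa>: "0 < \<kappa>"
      using assms 1 by simp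
    have f: "convex_on (Rd d) (f i) \<and> smooth_on_Rd d L (f i)" if "i \<in> {1..n}" for i
      using 1 that by blast
    note sc = strongly_convex_sum_Rd[OF \<open>L > 0\<close> 1(3) 1(1) n 1(6) 1(8) f 1(10)]
    have diff: "f i differentiable_on Rd d" if "i \<in> {1..n}" for i
      using f[OF that] by (simp add: smooth_on_Rd_def)
    obtain H b where H: "linear H" and grad_F: "\<And>x. x \<in> Rd d \<Longrightarrow> grad d F x = H x + b"
      using grad_quadratic[OF 1(7)] by blast
    have sum_grad: "(\<Sum>i\<in>{1..n}. grad d (f i) y) = real n *\<^sub>R (H y + b)" if "y \<in> Rd d" for y
      using grad_average[of n f d y, OF diff that n] grad_F[OF that] unfolding 1(6) by simp
    have xs: "xs \<in> Rd d"
      using 1(10) by (simp add: is_arg_min_def)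
    have "real n *\<^sub>R (H xs + b) = 0"
      using sum_grad[OF xs] strongly_convex_sum.grad_xs[OF sc(1)] by simp
    then have "H xs + b = 0"
      using n by simp
    \<comment> \<open>Stationarity at the minimizer absorbs the constant part of the affine
      gradient.\<close>
    then have "H (y - xs) = H y + b" for y
      using linear_diff[OF H, of y xs] by (simp add: eq_neg_iff_add_eq_0[symmetric])
    then have sum_H: "(\<Sum>i\<in>{1..n}. grad d (f i) y) = real n *\<^sub>R H (y - xs)" if "y \<in> Rd d" for y
      using sum_grad[OF that] by simp
    have iter: "shuffle_iter d n f \<eta> \<sigma> x0 k i \<in> S"
      if "\<And>k. \<sigma> k permutes {1..n}" "k \<in> {1..K}" "i \<in> {1..n}" for \<sigma> k i
      using 1(16) that by blast
    have bnd: "norm (grad d (f i) x) \<le> G" if "i \<in> {1..n}" "x \<in> insert x0 S" for i x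
    proof -
      have "norm (grad d (f i) x) \<in> grads"
        unfolding 1(17) using that hull_subset[of "insert x0 S" convex] by blast
      then show ?thesis
        using 1(19) by blast
    qed
    define T where "T = k0 + real n * real K"
    define P where "P = 640 * \<alpha> ^ 3 * G\<^sup>2 / L\<^sup>2 * \<kappa> ^ 4"
    define Q where "Q = (10240 * \<alpha> ^ 4 + 2 * c * (\<alpha> + 2)\<^sup>2) * G\<^sup>2 / L\<^sup>2 * \<kappa> ^ 6"
    define R where "R = (2 * (\<alpha> + 1)) powr \<alpha> * \<kappa> powr \<alpha> * (norm (x0 - xs))\<^sup>2"
    have PQR: "0 \<le> P" "0 \<le> Q" "0 \<le> R"
      using assms \<kappa> by (simp_all add: P_def Q_def R_def c_def)
    have T: "0 < T"
      using assms \<kappa> 1(5) by (simp add: T_def add_pos_nonneg)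
    have int: "integrable (measure_pmf (shuffle_pmf n K)) v" for v :: "_ \<Rightarrow> real"
      by (rule integrable_measure_pmf_finite[OF finite_set_shuffle_pmf])
    have "measure_pmf.expectation (shuffle_pmf n K) (\<lambda>\<sigma>. F (shuffle_iter d n f \<eta> \<sigma> x0 (Suc K) 0)) - F xs
        = measure_pmf.expectation (shuffle_pmf n K) (\<lambda>\<sigma>. F (shuffle_iter d n f \<eta> \<sigma> x0 K n) - F xs)"
      by (simp add: int)
    also have "\<dots> \<le> measure_pmf.expectation (shuffle_pmf n K) (\<lambda>\<sigma>. L / 2 * (norm (shuffle_iter d n f \<eta> \<sigma> x0 K n - xs))\<^sup>2)"
    proof (intro integral_mono_AE int, simp only: AE_measure_pmf_iff, intro ballI)
      fix \<sigma> assume "\<sigma> \<in> set_pmf (shuffle_pmf n K)"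
      then have "shuffle_iter d n f \<eta> \<sigma> x0 K n \<in> S"
        using 1(13) n by (intro iter set_shuffle_pmf_permutes) auto
      then show "F (shuffle_iter d n f \<eta> \<sigma> x0 K n) - F xs \<le> L / 2 * (norm (shuffle_iter d n f \<eta> \<sigma> x0 K n - xs))\<^sup>2"
        using 1(14) by (intro sc(2)) auto
    qed
    also have "\<dots> = L / 2 * measure_pmf.expectation (shuffle_pmf n K) (\<lambda>\<sigma>. (norm (shuffle_iter d n f \<eta> \<sigma> x0 K n - xs))\<^sup>2)"
      by (simp only: integral_mult_right_zero)
    also have "\<dots> \<le> L / 2 * (P / (T + n)\<^sup>2 + Q * (real n)\<^sup>2 / (T + n) ^ 3 + R / (T + n) powr \<alpha>)"
      using expected_distance_bound[OF sc(1) H sum_H \<alpha> 1(4) 1(5) 1(12) 1(11) 1(14) iter bnd c_def P_def Q_def R_def 1(13) order_refl]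
        assms by (intro mult_left_mono) (simp_all add: T_def)
    \<comment> \<open>The shift by n that the induction needed is now dropped, which only enlarges
      the bound.\<close>
    also have "\<dots> \<le> L / 2 * (P / T\<^sup>2 + Q * (real n)\<^sup>2 / T ^ 3 + R / T powr \<alpha>)"
      using assms PQR T by (intro mult_left_mono add_mono divide_left_mono power_mono powr_mono2 mult_pos_pos zero_less_power) auto
    also have "\<dots> = C1 * \<kappa> ^ 4 / T\<^sup>2 + C2 * \<kappa> ^ 6 * (real n)\<^sup>2 / T ^ 3
        + C3 * \<kappa> powr \<alpha> * (norm (x0 - xs))\<^sup>2 / T powr \<alpha>"
      by (simp add: C1_def C2_def C3_def P_def Q_def R_def distrib_left)
    finally have "measure_pmf.expectation (shuffle_pmf n K) (\<lambda>\<sigma>. F (shuffle_iter d n f \<eta> \<sigma> x0 (Suc K) 0)) - F xs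
        \<le> C1 * \<kappa> ^ 4 / T\<^sup>2 + C2 * \<kappa> ^ 6 * (real n)\<^sup>2 / T ^ 3
        + C3 * \<kappa> powr \<alpha> * (norm (x0 - xs))\<^sup>2 / T powr \<alpha>" .
    moreover have "C1 * \<kappa> ^ 4 \<le> (C1 + C2 + C3) * \<kappa> ^ 4" "C2 * \<kappa> ^ 6 \<le> (C1 + C2 + C3) * \<kappa> ^ 6"
      "C3 * \<kappa> powr \<alpha> \<le> (C1 + C2 + C3) * \<kappa> powr \<alpha>"
      using C \<kappa> by (auto intro!: mult_right_mono)
    ultimately show ?case
      unfolding T_def by blast
  qed
qed

end
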